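(* Assume the Strong Exponential Time Hypothesis (SETH) holds. Then for every $\epsilon>0$, the problem of determining, given an arbitrary trace $\sigma$, whether $\sigma$ has an optimistic sync-reversal data race cannot be solved in time $O(\mathcal{N}^{2-\epsilon})$, where $\mathcal{N}=|\mathsf{Events}(\sigma)|$.
   Context: **SETH.** For every $\delta>0$ there is $k$ such that $k$-SAT on $n$ variables cannot be solved in time $O(2^{(1-\delta)n})$. **Traces.** A trace $\sigma$ is a finite sequence of events; each event $e$ has a unique identifier, a thread $\mathsf{th}(e)$ and an operation $\mathsf{op}(e)$, which is one of $\mathsf{r}(x)$, $\mathsf{w}(x)$ (read/write of variable $x$), $\mathsf{acq}(\ell)$, $\mathsf{rel}(\ell)$ (acquire/release of lock $\ell$). $\mathsf{Events}(\sigma)$ is its set of events. Traces are well-formed: for each lock $\ell$, the operations on $\ell$ alternate between acquires and releases, each release being preceded by a matching acquire of the same thread. For an acquire (release) $e$, $\mathsf{match}_\sigma(e)$ is its matching release (acquire) in $\sigma$, or $\bot$ if none exists. **Orders.** $e_1\le^\sigma_{tr}e_2$ iff $e_1=e_2$ or $e_1$ appears before $e_2$ in $\sigma$; $e_1\le^\sigma_{TO}e_2$ iff $\mathsf{th}(e_1)=\mathsf{th}(e_2)$ and $e_1\le^\sigma_{tr}e_2$. For a read $r$ of $x$, $\mathsf{rf}_\sigma(r)$ is the last write on $x$ before $r$ in $\sigma$ (assumed always to exist in the given trace). $\mathsf{prev}_\sigma(e)$ is the last event $f\neq e$ with $f\le^\sigma_{TO}e$, or $\bot$ if none exists; conditions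 on $\mathsf{prev}_\sigma(e)$ are vacuous when it is $\bot$. A set $S\subseteq\mathsf{Events}(\sigma)$ is $(\le^\sigma_{TO},\mathsf{rf}_\sigma)$-closed if it is downward closed under $\le^\sigma_{TO}$ and contains $\mathsf{rf}_\sigma(r)$ for each read $r\in S$. $\mathsf{TRClosure}(e)$ is the smallest $(\le^\sigma_{TO},\mathsf{rf}_\sigma)$-closed set containing $e$. **Correct reordering.** A well-formed trace $\rho$ with $\mathsf{Events}(\rho)\subseteq\mathsf{Events}(\sigma)$ is a correct reordering of $\sigma$ if $\mathsf{Events}(\rho)$ is $(\le^\sigma_{TO},\mathsf{rf}_\sigma)$-closed, $e_1\le^\sigma_{TO}e_2$ implies $e_1\le^\rho_{TO}e_2$ for events of $\rho$, and $\mathsf{rf}_\rho(e)=\mathsf{rf}_\sigma(e)$ for every read $e$ of $\rho$. Two events conflict if they access the same variable and at least one is a write. An event $e$ is $\sigma$-enabled in $\rho$ if $e\notin\mathsf{Events}(\rho)$ but every $e'\ne e$ with $e'\le^\sigma_{TO}e$ is in $\mathsf{Events}(\rho)$. **Optimistic notions.** $S$ is optimistically lock-closed w.r.t. $(e_1,e_2)$ if (a) $e_1,e_2\notin S$ and $\mathsf{prev}_\sigma(e_1),\mathsf{prev}_\sigma(e_2)\in S$; (b) $S$ is $(\le^\sigma_{TO},\mathsf{rf}_\sigma)$-closed; (c) for every acquire $a\in S$ having a matching release, if neither $e_1$ nor $e_2$ is in $\mathsf{TRClosure}(\mathsf{match}_\sigma(a))$, then $\mathsf{match}_\sigma(a)\in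 S$. An optimistic correct reordering of $\sigma$ is a correct reordering $\rho$ of $\sigma$ such that any two conflicting events of $\rho$ are in the same relative order in $\rho$ as in $\sigma$, and any two distinct acquires of the same lock whose matching releases are both in $\rho$ are in the same relative order in $\rho$ as in $\sigma$. A pair of conflicting events $(e_1,e_2)$ of $\sigma$ is an optimistic sync-reversal data race if there is an optimistic correct reordering $\rho$ of $\sigma$ such that $\mathsf{Events}(\rho)$ is optimistically lock-closed w.r.t. $(e_1,e_2)$ and both $e_1,e_2$ are $\sigma$-enabled in $\rho$. *)

theory Defs
  imports Complex_Main "HOL-Library.Landau_Symbols" "HOL-Library.Log_Nat"
begin

section \<open>Model of computation\<close>

text \<open>
  Running time is measured on a deterministic random access machine with logarithmic cost:
  an instruction is charged the total bit length of the addresses and values it handles, so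
  registers may hold arbitrary naturals without giving the machine extra power.  Programs are
  structured (sequence, conditional, while) rather than using jumps, and the memory consists of
  arrays, finitely many of which are named in a given program; both choices change
  running times by at most a constant factor compared to a single memory and jumps.
\<close>

datatype arith = Add | Sub | Mul | Div

datatype expr =
    Const nat
  | Load nat expr  \<comment> \<open>static array name, computed address\<close>
  | Arith arith expr expr

datatype prog =
    Skip
  | Store nat expr expr  \<comment> \<open>static array name, computed address, value\<close>
  | Seq prog prog
  | Cond expr prog prog
  | While expr prog

type_synonym memory = "nat \<Rightarrow> nat \<Rightarrow> nat"

definition bits :: "nat \<Rightarrow> nat" where
  "bits n = max 1 (floorlog 2 n)"

text \<open>Subtraction is truncated at 0, and division by 0 yields 0.\<close>

fun arith_fun :: "arith \<Rightarrow> nat \<Rightarrow> nat \<Rightarrow> nat" where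
  "arith_fun Add x y = x + y"
| "arith_fun Sub x y = x - y"
| "arith_fun Mul x y = x * y"
| "arith_fun Div x y = x div y"

fun val :: "expr \<Rightarrow> memory \<Rightarrow> nat" where
  "val (Const n) s = n"
| "val (Load a e) s = s a (val e s)"
| "val (Arith f e1 e2) s = arith_fun f (val e1 s) (val e2 s)"

fun expr_cost :: "expr \<Rightarrow> memory \<Rightarrow> nat" where
  "expr_cost (Const n) s = bits n"
| "expr_cost (Load a e) s = expr_cost e s + bits (val e s) + bits (s a (val e s))"
| "expr_cost (Arith f e1 e2) s =
     expr_cost e1 s + expr_cost e2 s + bits (val e1 s) + bits (val e2 s)"

text \<open>\<open>exec p s t s'\<close>: started in memory \<open>s\<close>, program \<open>p\<close> halts at cost \<open>t\<close> in memory \<open>s'\<close>.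
  A guard counts as true if its value is nonzero.\<close>

inductive exec :: "prog \<Rightarrow> memory \<Rightarrow> nat \<Rightarrow> memory \<Rightarrow> bool" where
  Skip: "exec Skip s 1 s"
| Store: "exec (Store a e1 e2) s
            (expr_cost e1 s + expr_cost e2 s + bits (val e1 s) + bits (val e2 s))
            (s(a := (s a)(val e1 s := val e2 s)))"
| Seq: "exec p s t s' \<Longrightarrow> exec q s' u s'' \<Longrightarrow> exec (Seq p q) s (t + u) s''"
| CondTrue: "val e s \<noteq> 0 \<Longrightarrow> exec p s t s'
    \<Longrightarrow> exec (Cond e p q) s (expr_cost e s + bits (val e s) + t) s'"
| CondFalse: "val e s = 0 \<Longrightarrow> exec q s t s'
    \<Longrightarrow> exec (Cond e p q) s (expr_cost e s + bits (val e s) + t) s'"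
| WhileFalse: "val e s = 0 \<Longrightarrow> exec (While e p) s (expr_cost e s + bits (val e s)) s"
| WhileTrue: "val e s \<noteq> 0 \<Longrightarrow> exec p s t s' \<Longrightarrow> exec (While e p) s' u s''
    \<Longrightarrow> exec (While e p) s (expr_cost e s + bits (val e s) + t + u) s''"

text \<open>The input word is stored in array 0, preceded by its length; everything else is 0.
  The answer is yes iff cell 0 of array 1 is nonzero on termination.\<close>

definition input_memory :: "nat list \<Rightarrow> memory" where
  "input_memory xs = (\<lambda>a i.
     if a = 0 \<and> i \<le> length xs then (length xs # xs) ! i else 0)"

definition answers_within :: "prog \<Rightarrow> nat list \<Rightarrow> bool \<Rightarrow> real \<Rightarrow> bool" where
  "answers_within p xs b T \<longleftrightarrow>
     (\<exists>t s. exec p (input_memory xs) t s \<and> (s 1 0 \<noteq> 0 \<longleftrightarrow> b) \<and> real t \<le> T)"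

text \<open>The decision problem \<open>Q\<close> on the instances \<open>I\<close>, encoded by \<open>enc\<close>, can be solved in
  worst-case time \<open>O(f)\<close> with respect to the size parameter \<open>sz\<close>.\<close>

definition solvable_in_time ::
  "'a set \<Rightarrow> ('a \<Rightarrow> nat list) \<Rightarrow> ('a \<Rightarrow> nat) \<Rightarrow> ('a \<Rightarrow> bool) \<Rightarrow> (nat \<Rightarrow> real) \<Rightarrow> bool" where
  "solvable_in_time I enc sz Q f \<longleftrightarrow>
     (\<exists>p T. T \<in> O(f) \<and> (\<forall>x\<in>I. answers_within p (enc x) (Q x) (T (sz x))))"


section \<open>The Strong Exponential Time Hypothesis\<close>

text \<open>The literal \<open>(x, True)\<close> is the variable \<open>x\<close>, and \<open>(x, False)\<close> is its negation.\<close>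

type_synonym literal = "nat \<times> bool"
type_synonym clause = "literal list"
type_synonym cnf = "clause list"

text \<open>Clauses are sets of at most \<open>k\<close> literals and formulas are sets of clauses.  Without
  repetitions, the length of a k-CNF formula is polynomial in its number of variables, which
  is why a time bound in that number alone is meaningful.\<close>

definition kcnf :: "nat \<Rightarrow> nat \<Rightarrow> cnf \<Rightarrow> bool" where
  "kcnf k n \<phi> \<longleftrightarrow> distinct (map set \<phi>) \<and>
     (\<forall>c\<in>set \<phi>. distinct c \<and> length c \<le> k \<and> (\<forall>(x, b)\<in>set c. x < n))"

definition satisfiable :: "cnf \<Rightarrow> bool" where
  "satisfiable \<phi> \<longleftrightarrow> (\<exists>v :: nat \<Rightarrow> bool. \<forall>c\<in>set \<phi>. \<exists>(x, b)\<in>set c. v x = b)"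

definition ksat_instances :: "nat \<Rightarrow> (nat \<times> cnf) set" where
  "ksat_instances k = {(n, \<phi>). kcnf k n \<phi>}"

definition encode_literal :: "literal \<Rightarrow> nat" where
  "encode_literal l = 2 * fst l + of_bool (snd l)"

definition encode_cnf :: "nat \<times> cnf \<Rightarrow> nat list" where
  "encode_cnf F = fst F # length (snd F) #
     concat (map (\<lambda>c. length c # map encode_literal c) (snd F))"

definition SETH :: bool where
  "SETH \<longleftrightarrow> (\<forall>\<delta>::real. \<delta> > 0 \<longrightarrow> (\<exists>k.
     \<not> solvable_in_time (ksat_instances k) encode_cnf fst (\<lambda>F. satisfiable (snd F))
         (\<lambda>n. 2 powr ((1 - \<delta>) * real n))))"


section \<open>Traces\<close>

datatype operation = Read nat | Write nat | Acq nat | Rel nat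

datatype event = Event (ident: nat) (th: nat) (oper: operation)

type_synonym trace = "event list"

abbreviation Events :: "trace \<Rightarrow> event set" where
  "Events \<sigma> \<equiv> set \<sigma>"

definition is_acq :: "event \<Rightarrow> bool" where
  "is_acq e \<longleftrightarrow> (\<exists>l. oper e = Acq l)"

definition is_read :: "event \<Rightarrow> bool" where
  "is_read e \<longleftrightarrow> (\<exists>x. oper e = Read x)"

definition lock_events :: "trace \<Rightarrow> nat \<Rightarrow> event list" where
  "lock_events \<sigma> l = filter (\<lambda>e. oper e \<in> {Acq l, Rel l}) \<sigma>"

definition wf_trace :: "trace \<Rightarrow> bool" where
  "wf_trace \<sigma> \<longleftrightarrow> distinct (map ident \<sigma>) \<and>
     (\<forall>l. \<forall>i < length (lock_events \<sigma> l).
        if even i then oper (lock_events \<sigma> l ! i) = Acq l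
        else oper (lock_events \<sigma> l ! i) = Rel l \<and>
             th (lock_events \<sigma> l ! i) = th (lock_events \<sigma> l ! (i - 1)))"

definition events_before :: "trace \<Rightarrow> event \<Rightarrow> event list" where
  "events_before \<sigma> e = takeWhile (\<lambda>f. f \<noteq> e) \<sigma>"

definition events_after :: "trace \<Rightarrow> event \<Rightarrow> event list" where
  "events_after \<sigma> e = tl (dropWhile (\<lambda>f. f \<noteq> e) \<sigma>)"

text \<open>In a well-formed trace, the operations on a lock alternate, so the release matching an
  acquire of \<open>l\<close> is simply the first release of \<open>l\<close> after it, and dually for releases.\<close>

definition match :: "trace \<Rightarrow> event \<Rightarrow> event option" where
  "match \<sigma> e = (case oper e of
      Acq l \<Rightarrow> find (\<lambda>f. oper f = Rel l) (events_after \<sigma> e)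
    | Rel l \<Rightarrow> find (\<lambda>f. oper f = Acq l) (rev (events_before \<sigma> e))
    | _ \<Rightarrow> None)"

definition tr_le :: "trace \<Rightarrow> event \<Rightarrow> event \<Rightarrow> bool" where
  "tr_le \<sigma> e1 e2 \<longleftrightarrow> e1 \<in> Events \<sigma> \<and> e2 \<in> Events \<sigma> \<and>
     (e1 = e2 \<or> (\<exists>i j. i < j \<and> j < length \<sigma> \<and> \<sigma> ! i = e1 \<and> \<sigma> ! j = e2))"

definition TO_le :: "trace \<Rightarrow> event \<Rightarrow> event \<Rightarrow> bool" where
  "TO_le \<sigma> e1 e2 \<longleftrightarrow> th e1 = th e2 \<and> tr_le \<sigma> e1 e2"

definition rf :: "trace \<Rightarrow> event \<Rightarrow> event option" where
  "rf \<sigma> e = (case oper e of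
      Read x \<Rightarrow> find (\<lambda>f. oper f = Write x) (rev (events_before \<sigma> e))
    | _ \<Rightarrow> None)"

definition prev :: "trace \<Rightarrow> event \<Rightarrow> event option" where
  "prev \<sigma> e = find (\<lambda>f. th f = th e) (rev (events_before \<sigma> e))"

definition TO_rf_closed :: "trace \<Rightarrow> event set \<Rightarrow> bool" where
  "TO_rf_closed \<sigma> S \<longleftrightarrow> S \<subseteq> Events \<sigma> \<and>
     (\<forall>e\<in>S. \<forall>f. TO_le \<sigma> f e \<longrightarrow> f \<in> S) \<and>
     (\<forall>r\<in>S. is_read r \<longrightarrow> (\<exists>w\<in>S. rf \<sigma> r = Some w))"

definition TRClosure :: "trace \<Rightarrow> event \<Rightarrow> event set" where
  "TRClosure \<sigma> e = \<Inter> {S. TO_rf_closed \<sigma> S \<and> e \<in> S}"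


section \<open>Optimistic sync-reversal data races\<close>

definition correct_reordering :: "trace \<Rightarrow> trace \<Rightarrow> bool" where
  "correct_reordering \<sigma> \<rho> \<longleftrightarrow> wf_trace \<rho> \<and> Events \<rho> \<subseteq> Events \<sigma> \<and>
     TO_rf_closed \<sigma> (Events \<rho>) \<and>
     (\<forall>e1\<in>Events \<rho>. \<forall>e2\<in>Events \<rho>. TO_le \<sigma> e1 e2 \<longrightarrow> TO_le \<rho> e1 e2) \<and>
     (\<forall>e\<in>Events \<rho>. is_read e \<longrightarrow> rf \<rho> e = rf \<sigma> e)"

definition conflicting :: "event \<Rightarrow> event \<Rightarrow> bool" where
  "conflicting e1 e2 \<longleftrightarrow> e1 \<noteq> e2 \<and>
     (\<exists>x. oper e1 \<in> {Read x, Write x} \<and> oper e2 \<in> {Read x, Write x} \<and>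
          (oper e1 = Write x \<or> oper e2 = Write x))"

definition enabled :: "trace \<Rightarrow> trace \<Rightarrow> event \<Rightarrow> bool" where
  "enabled \<sigma> \<rho> e \<longleftrightarrow> e \<in> Events \<sigma> \<and> e \<notin> Events \<rho> \<and>
     (\<forall>e'. e' \<noteq> e \<and> TO_le \<sigma> e' e \<longrightarrow> e' \<in> Events \<rho>)"

definition opt_lock_closed :: "trace \<Rightarrow> event \<Rightarrow> event \<Rightarrow> event set \<Rightarrow> bool" where
  "opt_lock_closed \<sigma> e1 e2 S \<longleftrightarrow>
     (\<forall>e\<in>{e1, e2}. e \<notin> S \<and> (\<forall>f. prev \<sigma> e = Some f \<longrightarrow> f \<in> S)) \<and>
     TO_rf_closed \<sigma> S \<and>
     (\<forall>a\<in>S. \<forall>r. is_acq a \<and> match \<sigma> a = Some r \<and>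
        e1 \<notin> TRClosure \<sigma> r \<and> e2 \<notin> TRClosure \<sigma> r \<longrightarrow> r \<in> S)"

definition opt_correct_reordering :: "trace \<Rightarrow> trace \<Rightarrow> bool" where
  "opt_correct_reordering \<sigma> \<rho> \<longleftrightarrow> correct_reordering \<sigma> \<rho> \<and>
     (\<forall>e1\<in>Events \<rho>. \<forall>e2\<in>Events \<rho>. conflicting e1 e2 \<longrightarrow>
        (tr_le \<rho> e1 e2 \<longleftrightarrow> tr_le \<sigma> e1 e2)) \<and>
     (\<forall>a1\<in>Events \<rho>. \<forall>a2\<in>Events \<rho>. \<forall>l r1 r2.
        a1 \<noteq> a2 \<and> oper a1 = Acq l \<and> oper a2 = Acq l \<and>
        match \<sigma> a1 = Some r1 \<and> match \<sigma> a2 = Some r2 \<and>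
        r1 \<in> Events \<rho> \<and> r2 \<in> Events \<rho> \<longrightarrow>
        (tr_le \<rho> a1 a2 \<longleftrightarrow> tr_le \<sigma> a1 a2))"

definition osr_race :: "trace \<Rightarrow> event \<Rightarrow> event \<Rightarrow> bool" where
  "osr_race \<sigma> e1 e2 \<longleftrightarrow> e1 \<in> Events \<sigma> \<and> e2 \<in> Events \<sigma> \<and> conflicting e1 e2 \<and>
     (\<exists>\<rho>. opt_correct_reordering \<sigma> \<rho> \<and> opt_lock_closed \<sigma> e1 e2 (Events \<rho>) \<and>
          enabled \<sigma> \<rho> e1 \<and> enabled \<sigma> \<rho> e2)"

definition has_osr_race :: "trace \<Rightarrow> bool" where
  "has_osr_race \<sigma> \<longleftrightarrow> (\<exists>e1 e2. osr_race \<sigma> e1 e2)"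

text \<open>Inputs: arbitrary well-formed traces in which every read has a write to read from.  As part
  of the encoding, the at most \<open>N\<close> identifiers, threads, variables and locks occurring in a
  trace with \<open>N\<close> events are numbered by naturals below \<open>N\<close>.  The notions above are invariant
  under such a renaming; without it, names of unbounded bit length would make any time bound
  in \<open>N\<close> alone impossible for trivial reasons.\<close>

fun operand :: "operation \<Rightarrow> nat" where
  "operand (Read x) = x"
| "operand (Write x) = x"
| "operand (Acq l) = l"
| "operand (Rel l) = l"

fun opcode :: "operation \<Rightarrow> nat" where
  "opcode (Read x) = 0"
| "opcode (Write x) = 1"
| "opcode (Acq l) = 2"
| "opcode (Rel l) = 3"

definition trace_instances :: "trace set" where
  "trace_instances = {\<sigma>. wf_trace \<sigma> \<and>
     (\<forall>r\<in>Events \<sigma>. is_read r \<longrightarrow> rf \<sigma> r \<noteq> None) \<and>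
     (\<forall>e\<in>Events \<sigma>. ident e < card (Events \<sigma>) \<and> th e < card (Events \<sigma>) \<and>
        operand (oper e) < card (Events \<sigma>))}"

definition encode_trace :: "trace \<Rightarrow> nat list" where
  "encode_trace \<sigma> =
     concat (map (\<lambda>e. [ident e, th e, opcode (oper e), operand (oper e)]) \<sigma>)"

end

theory Submission
  imports Defs
begin

text \<open>
  A $k$-CNF formula with $n$ variables and $m$ clauses is turned into a trace with two threads.
  The variables are split into two halves; for every assignment of the first (second) half,
  the first (second) thread contains a block consisting of $m$ nested critical sections around a
  write of one common variable. The $c$-th lock of a block is a lock shared by the two threads
  if the assignment fails to satisfy clause $c$, and is private to the thread otherwise. Writes of
  the same thread are ordered, so a race consists of one block of each thread; both writes can be
  enabled simultaneously iff the two blocks hold no common lock, i.e. iff the two assignments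
  together satisfy every clause. As there are no reads, nothing else obstructs the reordering.

  The trace has $O(2^{n/2} m)$ events, so a race detector of time $O(N^{2-\epsilon})$ decides
  satisfiability in time $2^{(1-\epsilon/2)n}$ up to a polynomial factor in $n$, which for fixed
  $k$ also bounds $m$.
\<close>

section \<open>Traces of nested critical sections\<close>

text \<open>The optimistic conditions leave the reordering free for structural reasons. The two
  blocks of a candidate pair are entered but not left, so the release matching one of their acquires
  lies behind a racing write; thread order puts that write into the \<open>TRClosure\<close> of the
  release, and lock closure demands nothing. Completed blocks keep the order of \<sigma>, and only
  they contain executed writes or matched acquires.

  The other half of the work comes from the machine model: SETH speaks of concrete programs with
  logarithmic cost, so the reduction must be an explicit program with a proved cost. All its values
  fit into one word length \<open>w\<close>, polynomial in n for fixed k, and counting in units of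
  \<open>w\<close> reduces time bounds to counting statements. Writing the trace costs 2^(n/2) times
  a polynomial, which stays below the time of the detector. Half of the saving e/2 in the exponent
  is given up to absorb every polynomial factor, whence the final exponent 1 - e/4.\<close>

locale block_trace =
  fixes m H :: nat and hit :: "nat \<Rightarrow> nat \<Rightarrow> bool"
  assumes H_pos: "H > 0"
begin

definition L :: nat where "L = 2 * m + 1"

definition N :: nat where "N = 2 * H * L"

text \<open>Shared locks are numbered below \<open>m\<close>; the private ones are
  \<open>m + c\<close> in the first thread and \<open>2 * m + c\<close> in the second,
  \<open>q div H\<close> being the thread. The three ranges are disjoint, and all numbers stay below
  \<open>3 * m\<close>, hence below \<open>N\<close>, as the encoding of traces demands.\<close>

definition lk :: "nat \<Rightarrow> nat \<Rightarrow> nat" where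
  "lk q c = (if hit q c then m + c + m * (q div H) else c)"

text \<open>A block is a palindrome around its write at coordinate \<open>m\<close>: coordinate
  \<open>2 * m - c\<close> releases what coordinate \<open>c\<close> acquires, which makes the
  critical sections nested.\<close>

definition op_at :: "nat \<Rightarrow> operation" where
  "op_at p = (if p mod L < m then Acq (lk (p div L) (p mod L))
     else if p mod L = m then Write 0 else Rel (lk (p div L) (2 * m - p mod L)))"

definition ev :: "nat \<Rightarrow> event" where
  "ev p = Event p (p div L div H) (op_at p)"

definition \<sigma> :: trace where "\<sigma> = map ev [0..<N]"

lemma ev_simps [simp]: "ident (ev p) = p" "th (ev p) = p div L div H" "oper (ev p) = op_at p"
  by (simp_all add: ev_def)

lemma ev_inj [simp]: "ev p = ev q \<longleftrightarrow> p = q"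
  by (metis ev_simps(1))

lemma inj_ev: "inj_on ev A"
  by (simp add: inj_on_def)

lemma L_pos [simp]: "L > 0"
  by (simp add: L_def)

lemma rel_coord: "m < p mod L \<Longrightarrow> 2 * m - p mod L < m"
  using mod_less_divisor[OF L_pos, of p] unfolding L_def by linarith

lemma pos_div [simp]: "o' < L \<Longrightarrow> (q * L + o') div L = q"
  and pos_mod [simp]: "o' < L \<Longrightarrow> (q * L + o') mod L = o'"
  by auto

lemma rel_pos [simp]:
  assumes "c \<le> 2 * m"
  shows "(q * L + 2 * m - c) div L = q" "(q * L + 2 * m - c) mod L = 2 * m - c"
proof -
  have "q * L + 2 * m - c = q * L + (2 * m - c)" "2 * m - c < L"
    using assms by (simp_all add: L_def)
  then show "(q * L + 2 * m - c) div L = q" "(q * L + 2 * m - c) mod L = 2 * m - c"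
    by (simp_all only: pos_div pos_mod)
qed

lemma set_\<sigma>: "Events \<sigma> = ev ` {..<N}"
  by (auto simp: \<sigma>_def)

lemma card_\<sigma>: "card (Events \<sigma>) = N"
  by (simp add: set_\<sigma> card_image inj_ev)

lemma op_Acq: "op_at p = Acq l \<longleftrightarrow> p mod L < m \<and> lk (p div L) (p mod L) = l"
  by (auto simp: op_at_def)

lemma op_Rel: "op_at p = Rel l \<longleftrightarrow> p mod L > m \<and> lk (p div L) (2 * m - p mod L) = l"
  by (auto simp: op_at_def)

lemma op_Write: "op_at p = Write x \<longleftrightarrow> p mod L = m \<and> x = 0"
  by (auto simp: op_at_def)

lemma op_not_Read [simp]: "op_at p \<noteq> Read x"
  by (auto simp: op_at_def)

text \<open>The ranges of \<open>lk\<close> are disjoint and each determines the clause. Thus a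
  block never requests a lock that it already holds.\<close>

lemma lk_same_block: "lk q c = lk q d \<Longrightarrow> c < m \<Longrightarrow> d < m \<Longrightarrow> c = d"
  by (auto simp: lk_def split: if_splits)

text \<open>Private locks of different threads lie in different ranges, so a common lock must be a
  shared one.\<close>

lemma lk_two_threads:
  assumes "i < H" "j < H" "c < m" "d < m" "lk i c = lk (H + j) d"
  shows "c = d \<and> \<not> hit i c \<and> \<not> hit (H + j) c"
proof -
  have "i div H = 0" "(H + j) div H = 1"
    using assms H_pos by auto
  then show ?thesis
    using assms by (auto simp: lk_def split: if_splits)
qed

lemma block_range: "p < N \<Longrightarrow> p div L < 2 * H"
  by (simp add: N_def less_mult_imp_div_less)

lemma pos_less_N: "q < 2 * H \<Longrightarrow> o' < L \<Longrightarrow> q * L + o' < N"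
proof -
  assume "q < 2 * H" "o' < L"
  then have "q * L + o' < Suc q * L" by simp
  also have "\<dots> \<le> 2 * H * L" using \<open>q < 2 * H\<close> by (intro mult_le_mono1) simp
  finally show ?thesis by (simp add: N_def)
qed

lemma div_less_L: "p < q * L \<longleftrightarrow> p div L < q"
  by (simp add: div_less_iff_less_mult)

lemma operand_bound: assumes "p < N" shows "operand (op_at p) < N"
proof -
  have q: "p div L div H \<le> 1"
    using block_range[OF assms] H_pos by (simp add: less_mult_imp_div_less less_Suc_eq_le[symmetric])
  have "lk (p div L) c < N" if "c < m" for c
  proof -
    have "m * (p div L div H) \<le> m" using q by (metis mult.right_neutral mult_le_mono2)
    moreover have "lk (p div L) c \<le> m + c + m * (p div L div H)" by (simp add: lk_def)
    ultimately have "lk (p div L) c < 3 * m" using that by linarith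
    also have "3 * m \<le> 2 * L" by (simp add: L_def)
    also have "\<dots> \<le> N" using H_pos by (simp add: N_def)
    finally show ?thesis .
  qed
  then show ?thesis
    using assms rel_coord H_pos by (auto simp: op_at_def N_def)
qed

section \<open>Well-formedness of the trace\<close>

lemma lock_events_map:
  "lock_events (map ev ps) l = map ev (filter (\<lambda>p. op_at p \<in> {Acq l, Rel l}) ps)"
  by (simp add: lock_events_def filter_map o_def)

text \<open>The condition of \<open>wf_trace\<close> on a single lock, isolated so that it can be
  checked block by block.\<close>

definition alternating :: "nat \<Rightarrow> event list \<Rightarrow> bool" where
  "alternating l es \<longleftrightarrow> (\<forall>i < length es.
        if even i then oper (es ! i) = Acq l
        else oper (es ! i) = Rel l \<and> th (es ! i) = th (es ! (i - 1)))"

lemma alternatingD: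
  assumes "alternating l es" "i < length es"
  shows "even i \<Longrightarrow> oper (es ! i) = Acq l"
    "odd i \<Longrightarrow> oper (es ! i) = Rel l" "odd i \<Longrightarrow> th (es ! i) = th (es ! (i - 1))"
  using assms by (auto simp: alternating_def)

text \<open>An alternating list of even length ends with a release, so the second list may start
  afresh with an acquire.\<close>

lemma alternating_append:
  assumes "even (length xs)" "alternating l xs" "alternating l ys"
  shows "alternating l (xs @ ys)"
  unfolding alternating_def
proof (intro allI impI)
  fix i assume i: "i < length (xs @ ys)"
  show "if even i then oper ((xs @ ys) ! i) = Acq l
        else oper ((xs @ ys) ! i) = Rel l \<and> th ((xs @ ys) ! i) = th ((xs @ ys) ! (i - 1))"
  proof (cases "i < length xs")
    case True
    then show ?thesis
      using alternatingD[OF assms(2), of i] less_imp_diff_less[OF True, of 1]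
      by (simp add: nth_append)
  next
    case False
    define d where "d = i - length xs"
    have d: "i = length xs + d" "d < length ys"
      using False i by (auto simp: d_def)
    show ?thesis
    proof (cases "even d")
      case True
      then show ?thesis using assms(1) d alternatingD[OF assms(3), of d] by (simp add: nth_append)
    next
      case odd: False
      then have "d > 0" by (cases d) auto
      then have "i - 1 = length xs + (d - 1)" using d by simp
      then show ?thesis
        using assms(1) d odd alternatingD[OF assms(3), of d] by (simp add: nth_append)
    qed
  qed
qed

text \<open>Since \<open>lk q\<close> is injective on clauses, a lock is either absent from a block
  or occurs there as one acquire and its mirror image.\<close>

lemma filter_lock_block:
  "filter (\<lambda>p. op_at p \<in> {Acq l, Rel l}) [q * L..<Suc q * L] =
     (if \<exists>c<m. lk q c = l
      then let c = (SOME c. c < m \<and> lk q c = l) in [q * L + c, q * L + (2 * m - c)] else [])"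
  (is "?F = _")
proof (cases "\<exists>c<m. lk q c = l")
  case True
  define c where "c = (SOME c. c < m \<and> lk q c = l)"
  have c: "c < m" "lk q c = l"
    using someI_ex[of "\<lambda>c. c < m \<and> lk q c = l"] True by (auto simp: c_def)
  have "?F = [q * L + c, q * L + (2 * m - c)]"
  proof (rule sorted_distinct_set_unique)
    show "set ?F = set [q * L + c, q * L + (2 * m - c)]"
    proof (intro equalityI subsetI)
      fix p assume "p \<in> set ?F"
      then have p: "q * L \<le> p" "p < Suc q * L" "op_at p = Acq l \<or> op_at p = Rel l" by auto
      then have "p div L = q"
        by (metis div_less_L less_Suc_eq not_less)
      then have pq: "p = q * L + p mod L" by (metis div_mult_mod_eq)
      have "p mod L = c \<or> p mod L = 2 * m - c"
      proof -
        have "2 * m - p mod L = c \<Longrightarrow> p mod L = 2 * m - c"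
          using mod_less_divisor[OF L_pos, of p] unfolding L_def by linarith
        moreover have "p mod L = c" if "op_at p = Acq l"
          using that c \<open>p div L = q\<close> lk_same_block[of q "p mod L" c] by (simp add: op_Acq)
        moreover have "2 * m - p mod L = c" if "op_at p = Rel l"
          using that c \<open>p div L = q\<close> rel_coord lk_same_block[of q "2 * m - p mod L" c]
          by (simp add: op_Rel)
        ultimately show ?thesis
          using p(3) by blast
      qed
      then show "p \<in> set [q * L + c, q * L + (2 * m - c)]" using pq by auto
    next
      fix p assume "p \<in> set [q * L + c, q * L + (2 * m - c)]"
      moreover have "c < L" "2 * m - c < L" using c by (auto simp: L_def)
      ultimately show "p \<in> set ?F"
        using c by (auto simp: op_Acq op_Rel)
    qed
  qed (use c in \<open>auto intro: sorted_wrt_filter\<close>)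
  with True show ?thesis by (auto simp: c_def Let_def)
next
  case False
  have "p \<notin> set ?F" for p
  proof
    assume "p \<in> set ?F"
    then have p: "q * L \<le> p" "p < Suc q * L" "op_at p = Acq l \<or> op_at p = Rel l" by auto
    then have "p div L = q"
      by (metis div_less_L less_Suc_eq not_less)
    then show False
      using p(3) False rel_coord by (auto simp: op_Acq op_Rel)
  qed
  then show ?thesis using False by (metis last_in_set)
qed

lemma alternating_block:
  "alternating l (lock_events (map ev [q * L..<Suc q * L]) l)"
  "even (length (lock_events (map ev [q * L..<Suc q * L]) l))"
proof -
  define c where "c = (SOME c. c < m \<and> lk q c = l)"
  have c: "c < m \<and> lk q c = l" if "\<exists>c<m. lk q c = l"
    unfolding c_def using someI_ex[of "\<lambda>c. c < m \<and> lk q c = l"] that by auto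
  have L: "c < m \<Longrightarrow> c < L" "2 * m - c < L" by (simp_all add: L_def)
  have "alternating l (lock_events (map ev [q * L..<Suc q * L]) l) \<and>
    even (length (lock_events (map ev [q * L..<Suc q * L]) l))"
  proof (cases "\<exists>c<m. lk q c = l")
    case True
    then have "c < m" "lk q c = l" "m < 2 * m - c" using c by auto
    then show ?thesis
      unfolding lock_events_map filter_lock_block c_def[symmetric] Let_def
      using True L by (simp add: alternating_def less_Suc_eq op_Acq op_Rel)
  next
    case False
    then show ?thesis
      unfolding lock_events_map filter_lock_block
      by (simp only: False if_False) (simp add: alternating_def)
  qed
  then show "alternating l (lock_events (map ev [q * L..<Suc q * L]) l)"
    "even (length (lock_events (map ev [q * L..<Suc q * L]) l))"
    by blast+
qed

lemma alternating_blocks: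
  assumes "a \<le> b"
  shows "alternating l (lock_events (map ev [a * L..<b * L]) l) \<and>
     even (length (lock_events (map ev [a * L..<b * L]) l))"
  using assms
proof (induction b rule: dec_induct)
  case base
  then show ?case by (simp add: lock_events_def alternating_def)
next
  case (step b)
  have "a * L \<le> b * L" using step by simp
  then have "[a * L..<Suc b * L] = [a * L..<b * L] @ [b * L..<Suc b * L]"
    using upt_add_eq_append[of "a * L" "b * L" L] by (simp add: add.commute)
  then have "lock_events (map ev [a * L..<Suc b * L]) l =
     lock_events (map ev [a * L..<b * L]) l @ lock_events (map ev [b * L..<Suc b * L]) l"
    by (simp add: lock_events_def)
  then show ?case
    using step alternating_block[where l = l and q = b]
    by (simp only: length_append alternating_append even_add simp_thms)
qed

lemma wf_trace_map:
  "wf_trace (map ev ps) \<longleftrightarrow> distinct ps \<and> (\<forall>l. alternating l (lock_events (map ev ps) l))"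
  by (simp add: wf_trace_def alternating_def o_def)

lemma wf_\<sigma>: "wf_trace \<sigma>"
  using alternating_blocks[of 0 "2 * H"]
  by (simp add: \<sigma>_def wf_trace_map N_def)

lemma \<sigma>_instance: "\<sigma> \<in> trace_instances"
proof -
  have "2 * H * L \<ge> 2 * H * 1" using L_pos by (intro mult_le_mono2) (simp add: Suc_leI)
  then have "2 \<le> N" using H_pos by (simp add: N_def)
  moreover have "p div L div H < 2" if "p < N" for p
    using block_range[OF that] by (simp add: less_mult_imp_div_less)
  ultimately have "p div L div H < N" if "p < N" for p
    using that by (meson order_less_le_trans)
  then show ?thesis
    using wf_\<sigma> operand_bound unfolding trace_instances_def card_\<sigma>
    by (auto simp: set_\<sigma> is_read_def card_image inj_ev)
qed

section \<open>Thread order, closure and matching in terms of positions\<close>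

lemma tr_le_map:
  assumes "distinct ps" "i < length ps" "j < length ps"
  shows "tr_le (map ev ps) (ev (ps ! i)) (ev (ps ! j)) \<longleftrightarrow> i \<le> j"
proof
  assume "tr_le (map ev ps) (ev (ps ! i)) (ev (ps ! j))"
  then show "i \<le> j"
    using assms unfolding tr_le_def by (auto simp: nth_eq_iff_index_eq)
next
  assume le: "i \<le> j"
  show "tr_le (map ev ps) (ev (ps ! i)) (ev (ps ! j))"
  proof (cases "i = j")
    case False
    then have "\<exists>i' j'. i' < j' \<and> j' < length (map ev ps) \<and> map ev ps ! i' = ev (ps ! i)
        \<and> map ev ps ! j' = ev (ps ! j)"
      using assms le by (intro exI[of _ i] exI[of _ j]) auto
    then show ?thesis using assms by (simp add: tr_le_def)
  qed (use assms in \<open>simp add: tr_le_def\<close>)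
qed

text \<open>Distinctness makes the index of an event unique, and sortedness turns comparison of
  indices into comparison of positions. With empty \<open>qs\<close> this describes \<sigma> itself,
  otherwise the completed part of the reordering.\<close>

lemma tr_le_sorted_prefix:
  assumes "distinct (ps @ qs)" "sorted ps" "p \<in> set ps" "p' \<in> set ps"
  shows "tr_le (map ev (ps @ qs)) (ev p) (ev p') \<longleftrightarrow> p \<le> p'"
proof -
  obtain i j where ij: "i < length ps" "ps ! i = p" "j < length ps" "ps ! j = p'"
    using assms by (auto simp: in_set_conv_nth)
  have "tr_le (map ev (ps @ qs)) (ev p) (ev p') \<longleftrightarrow> i \<le> j"
    using tr_le_map[of "ps @ qs" i j] ij assms(1) by (auto simp: nth_append simp del: map_append)
  also have "\<dots> \<longleftrightarrow> p \<le> p'"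
    using ij assms by (metis distinct_append linorder_le_cases nle_le nth_eq_iff_index_eq
        sorted_iff_nth_mono)
  finally show ?thesis .
qed

lemma tr_le_append:
  assumes "distinct (ps @ qs)" "p \<in> set ps" "p' \<in> set qs"
  shows "tr_le (map ev (ps @ qs)) (ev p) (ev p')"
proof -
  obtain i j where ij: "i < length ps" "ps ! i = p" "j < length qs" "qs ! j = p'"
    using assms by (auto simp: in_set_conv_nth)
  then show ?thesis
    using tr_le_map[of "ps @ qs" i "length ps + j"] assms(1)
    by (auto simp: nth_append simp del: map_append)
qed

lemma tr_le_sorted_suffix:
  assumes "distinct (ps @ qs)" "sorted qs" "p \<in> set qs" "p' \<in> set qs" "p \<le> p'"
  shows "tr_le (map ev (ps @ qs)) (ev p) (ev p')"
proof -
  obtain i j where ij: "i < length qs" "qs ! i = p" "j < length qs" "qs ! j = p'"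
    using assms by (auto simp: in_set_conv_nth)
  have "i \<le> j"
    using ij assms by (metis distinct_append linorder_le_cases nle_le nth_eq_iff_index_eq
        sorted_iff_nth_mono)
  then show ?thesis
    using tr_le_map[of "ps @ qs" "length ps + i" "length ps + j"] ij assms(1)
    by (auto simp: nth_append simp del: map_append)
qed

lemma tr_le_\<sigma>: "p < N \<Longrightarrow> p' < N \<Longrightarrow> tr_le \<sigma> (ev p) (ev p') \<longleftrightarrow> p \<le> p'"
  using tr_le_sorted_prefix[of "[0..<N]" "[]"] by (simp add: \<sigma>_def)

lemma TO_le_\<sigma>: "p < N \<Longrightarrow> p' < N \<Longrightarrow>
    TO_le \<sigma> (ev p) (ev p') \<longleftrightarrow> p div L div H = p' div L div H \<and> p \<le> p'"
  by (simp add: TO_le_def tr_le_\<sigma>)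

lemma TO_le_events: "TO_le \<sigma> e f \<Longrightarrow> e \<in> Events \<sigma> \<and> f \<in> Events \<sigma>"
  by (simp add: TO_le_def tr_le_def)

text \<open>There are no reads, so only closure under thread order remains.\<close>

lemma TO_rf_closed_\<sigma>:
  "TO_rf_closed \<sigma> (ev ` P) \<longleftrightarrow> P \<subseteq> {..<N} \<and>
     (\<forall>p\<in>P. \<forall>p'\<le>p. p' div L div H = p div L div H \<longrightarrow> p' \<in> P)"
proof -
  have "ev ` P \<subseteq> Events \<sigma> \<longleftrightarrow> P \<subseteq> {..<N}"
    by (auto simp: set_\<sigma>)
  moreover have "(\<forall>e\<in>ev ` P. \<forall>f. TO_le \<sigma> f e \<longrightarrow> f \<in> ev ` P) \<longleftrightarrow>
     (\<forall>p\<in>P. \<forall>p'\<le>p. p' div L div H = p div L div H \<longrightarrow> p' \<in> P)" if P: "P \<subseteq> {..<N}"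
  proof (intro iffI ballI allI impI)
    fix p p'
    assume *: "\<forall>e\<in>ev ` P. \<forall>f. TO_le \<sigma> f e \<longrightarrow> f \<in> ev ` P" "p \<in> P" "p' \<le> p"
      "p' div L div H = p div L div H"
    then have "p < N" "p' < N" using P by (auto intro: order_le_less_trans)
    then have "TO_le \<sigma> (ev p') (ev p)" using * by (simp add: TO_le_\<sigma>)
    then have "ev p' \<in> ev ` P" using * by blast
    then show "p' \<in> P" by auto
  next
    fix e f
    assume *: "\<forall>p\<in>P. \<forall>p'\<le>p. p' div L div H = p div L div H \<longrightarrow> p' \<in> P" "e \<in> ev ` P" "TO_le \<sigma> f e"
    then obtain p p' where "e = ev p" "p \<in> P" "f = ev p'" "p' < N"
      using TO_le_events by (fastforce simp: set_\<sigma>)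
    with * P show "f \<in> ev ` P" by (auto simp: TO_le_\<sigma> subset_iff)
  qed
  ultimately show ?thesis
    unfolding TO_rf_closed_def by (auto simp: is_read_def)
qed

lemma events_before_\<sigma>: "p < N \<Longrightarrow> events_before \<sigma> (ev p) = map ev [0..<p]"
proof -
  assume "p < N"
  then have "[0..<N] = [0..<p] @ p # [Suc p..<N]"
    by (metis le_add_diff_inverse less_imp_le_nat upt_add_eq_append upt_conv_Cons zero_le)
  then show ?thesis
    unfolding events_before_def \<sigma>_def
    by (simp, subst takeWhile_append2) auto
qed

lemma events_after_\<sigma>: "p < N \<Longrightarrow> events_after \<sigma> (ev p) = map ev [Suc p..<N]"
proof -
  assume "p < N"
  then have "[0..<N] = [0..<p] @ p # [Suc p..<N]"
    by (metis le_add_diff_inverse less_imp_le_nat upt_add_eq_append upt_conv_Cons zero_le)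
  then show ?thesis
    unfolding events_after_def \<sigma>_def
    by (simp, subst dropWhile_append2) auto
qed

lemma prev_\<sigma>: "p < N \<Longrightarrow> prev \<sigma> (ev p) = Some f \<Longrightarrow>
    \<exists>p'<p. f = ev p' \<and> p' div L div H = p div L div H"
  by (auto simp: prev_def events_before_\<sigma> find_Some_iff rev_map[symmetric] in_set_conv_nth[symmetric]
      rev_nth)

text \<open>The mirror image \<open>x\<close> of \<open>p\<close> releases the same lock, so the
  first such release lies between \<open>p\<close> and \<open>x\<close> and hence in the same block.
  All releases of a block come after its write, which is what the race argument needs.\<close>

lemma match_acquire:
  assumes "p < N" "p mod L < m" "match \<sigma> (ev p) = Some r"
  shows "\<exists>p'. r = ev p' \<and> p' div L = p div L \<and> p' mod L > m \<and> p' < N"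
proof -
  define l where "l = lk (p div L) (p mod L)"
  have op: "op_at p = Acq l" using assms by (simp add: op_Acq l_def)
  define x where "x = (p div L) * L + (2 * m - p mod L)"
  have xL: "2 * m - p mod L < L" by (simp add: L_def)
  have x: "x < N" "p < x" "op_at x = Rel l"
  proof -
    show "x < N" unfolding x_def using pos_less_N block_range assms xL by blast
    have "p = (p div L) * L + p mod L" by simp
    also have "\<dots> < x" unfolding x_def using assms by linarith
    finally show "p < x" .
    show "op_at x = Rel l" unfolding x_def using assms xL by (simp add: op_Rel l_def)
  qed
  have "find (\<lambda>f. oper f = Rel l) (map ev [Suc p..<N]) = Some r"
    using assms op by (simp add: match_def events_after_\<sigma>)
  then obtain i where i: "i < N - Suc p" "op_at (Suc p + i) = Rel l" "r = ev (Suc p + i)"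
    "\<And>j. j < i \<Longrightarrow> op_at (Suc p + j) \<noteq> Rel l"
    by (auto simp: find_Some_iff)
  have "\<not> x - Suc p < i" using i(4)[of "x - Suc p"] x by auto
  then have le: "Suc p + i \<le> x" using x by linarith
  have "(Suc p + i) div L \<le> x div L" using le by (rule div_le_mono)
  moreover have "p div L \<le> (Suc p + i) div L" by (rule div_le_mono) simp
  moreover have "x div L = p div L" using xL by (simp add: x_def)
  ultimately have "(Suc p + i) div L = p div L" by simp
  then show ?thesis using i by (auto simp: op_Rel)
qed

lemma mem_TRClosure: "TO_le \<sigma> e r \<Longrightarrow> e \<in> TRClosure \<sigma> r"
  by (auto simp: TRClosure_def TO_rf_closed_def)

section \<open>From a race to a covering pair of blocks\<close>

lemma tr_le_Cons: "tr_le (a # ps) e f \<longleftrightarrow> e = a \<and> f \<in> set (a # ps) \<or> tr_le ps e f"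
proof
  assume t: "tr_le (a # ps) e f"
  show "e = a \<and> f \<in> set (a # ps) \<or> tr_le ps e f"
  proof (cases "e = f")
    case False
    with t obtain i j where ij: "i < j" "j < length (a # ps)" "(a # ps) ! i = e" "(a # ps) ! j = f"
      unfolding tr_le_def by blast
    then obtain j' where j': "j = Suc j'" by (cases j) auto
    show ?thesis
    proof (cases i)
      case 0
      then show ?thesis using ij by (auto simp: j')
    next
      case (Suc i')
      have "e \<in> set ps" "f \<in> set ps" "i' < j'" "j' < length ps" "ps ! i' = e" "ps ! j' = f"
        using ij by (auto simp: j' Suc)
      then show ?thesis unfolding tr_le_def by blast
    qed
  qed (use t in \<open>auto simp: tr_le_def\<close>)
next
  assume "e = a \<and> f \<in> set (a # ps) \<or> tr_le ps e f"
  then show "tr_le (a # ps) e f"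
  proof
    assume a: "e = a \<and> f \<in> set (a # ps)"
    then obtain j where j: "j < length (a # ps)" "(a # ps) ! j = f" by (meson in_set_conv_nth)
    have "a = f \<or> (\<exists>i j. i < j \<and> j < length (a # ps) \<and> (a # ps) ! i = a \<and> (a # ps) ! j = f)"
    proof (cases j)
      case (Suc j')
      then show ?thesis using j by (intro disjI2 exI[of _ 0] exI[of _ j]) auto
    qed (use j in simp)
    then show ?thesis using a unfolding tr_le_def by auto
  next
    assume t: "tr_le ps e f"
    have "\<exists>i j. i < j \<and> j < length (a # ps) \<and> (a # ps) ! i = e \<and> (a # ps) ! j = f"
      if "i < j" "j < length ps" "ps ! i = e" "ps ! j = f" for i j
      using that by (intro exI[of _ "Suc i"] exI[of _ "Suc j"]) auto
    then show ?thesis using t unfolding tr_le_def by (metis list.set_intros(2))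
  qed
qed

text \<open>The recursive form of \<open>tr_le\<close> makes this an induction. It carries the order
  inside the history of one lock back to the whole trace.\<close>

lemma tr_le_filter: "tr_le (filter Q ps) e f \<Longrightarrow> tr_le ps e f"
  by (induction ps) (auto simp: tr_le_Cons split: if_splits)

lemma tr_le_antisym: "distinct ps \<Longrightarrow> tr_le ps e f \<Longrightarrow> tr_le ps f e \<Longrightarrow> e = f"
  unfolding tr_le_def by (metis nth_eq_iff_index_eq order_less_asym order_less_trans)

lemma wf_distinct: "wf_trace ps \<Longrightarrow> distinct ps"
  by (simp add: wf_trace_def distinct_map)

text \<open>A block whose write is not yet executed still holds its locks, since thread order
  forces every earlier release of the thread to precede the acquire.\<close>

lemma held_lock_last:
  assumes cr: "correct_reordering \<sigma> \<rho>" and "q < 2 * H" "c < m"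
    and w: "ev (q * L + m) \<notin> Events \<rho>" and a: "ev (q * L + c) \<in> Events \<rho>"
    and u: "u < length (lock_events \<rho> (lk q c))" "lock_events \<rho> (lk q c) ! u = ev (q * L + c)"
  shows "Suc u = length (lock_events \<rho> (lk q c))"
proof (rule ccontr)
  define l where "l = lk q c"
  define es where "es = lock_events \<rho> l"
  assume "Suc u \<noteq> length (lock_events \<rho> (lk q c))"
  then have u': "Suc u < length es" "u < length es" "es ! u = ev (q * L + c)"
    using u by (auto simp: es_def l_def)
  have cL: "c < L" "m < L" using assms by (auto simp: L_def)
  have alt: "alternating l es"
    using cr by (simp add: correct_reordering_def wf_trace_def alternating_def es_def)
  have "op_at (q * L + c) = Acq l" using assms cL by (simp add: op_Acq l_def)
  then have "even u"
    using alternatingD(2)[OF alt u'(2)] u'(3) by auto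
  \<comment> \<open>If the acquire were not the last event on its lock, a release by the same thread
    would follow it.\<close>
  then have r: "oper (es ! Suc u) = Rel l" "th (es ! Suc u) = th (es ! u)"
    using alternatingD[OF alt u'(1)] by auto
  define r where "r = es ! Suc u"
  have rin: "r \<in> Events \<rho>"
    using nth_mem[OF u'(1)] by (auto simp: r_def es_def lock_events_def)
  have sub: "Events \<rho> \<subseteq> Events \<sigma>" and cl: "TO_rf_closed \<sigma> (Events \<rho>)"
    using cr by (auto simp: correct_reordering_def)
  obtain p where p: "r = ev p" "p < N" using rin sub by (auto simp: set_\<sigma>)
  have thp: "p div L div H = q div H"
    using r(2) u' p cL by (simp add: r_def)
  have rel: "m < p mod L" using r(1) p by (simp add: r_def op_Rel)
  have wN: "q * L + m < N" "q * L + c < N" using pos_less_N assms cL by auto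
  \<comment> \<open>A release behind the write would force the write into \<rho>, because \<rho> is
    closed under thread order.\<close>
  have "p < q * L + m"
  proof (rule ccontr)
    assume "\<not> p < q * L + m"
    then have "TO_le \<sigma> (ev (q * L + m)) r" using p thp wN cL by (simp add: TO_le_\<sigma>)
    then show False using cl rin w by (auto simp: TO_rf_closed_def)
  qed
  \<comment> \<open>Releases have coordinates above \<open>m\<close>. One that precedes the write of
    block \<open>q\<close> therefore lies in an earlier block and precedes even the acquire, against
    its place in \<rho>.\<close>
  then have "p div L * L + p mod L < q * L + m" by simp
  then have "p div L * L < q * L" using rel by linarith
  then have "p < q * L + c" by (simp add: div_less_L trans_less_add1)
  then have "TO_le \<sigma> r (ev (q * L + c))" using p thp wN cL by (simp add: TO_le_\<sigma>)
  then have "tr_le \<rho> r (ev (q * L + c))"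
    using cr rin a unfolding correct_reordering_def TO_le_def[of \<rho>] by blast
  moreover have "tr_le es (ev (q * L + c)) r"
    using u' nth_mem[OF u'(1)] nth_mem[OF u'(2)] unfolding tr_le_def r_def
    by (metis lessI)
  then have "tr_le \<rho> (ev (q * L + c)) r"
    unfolding es_def lock_events_def by (rule tr_le_filter)
  moreover have "distinct \<rho>"
    using cr by (auto simp: correct_reordering_def intro: wf_distinct)
  ultimately have "r = ev (q * L + c)" using tr_le_antisym by blast
  then show False using \<open>p < q * L + c\<close> p by simp
qed

text \<open>If neither block hits clause \<open>c\<close>, both hold the shared lock
  \<open>c\<close>. By \<open>held_lock_last\<close> each of the two acquires would be the last
  event on that lock, although they differ.\<close>

lemma race_imp_cover:
  assumes cr: "correct_reordering \<sigma> \<rho>" and ij: "i < H" "j < H"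
    and en: "enabled \<sigma> \<rho> (ev (i * L + m))" "enabled \<sigma> \<rho> (ev ((H + j) * L + m))"
    and c: "c < m"
  shows "hit i c \<or> hit (H + j) c"
proof (rule ccontr)
  assume no: "\<not> (hit i c \<or> hit (H + j) c)"
  have cL: "c < L" "m < L" using c by (auto simp: L_def)
  have acq: "\<exists>u. u < length (lock_events \<rho> c) \<and> lock_events \<rho> c ! u = ev (q * L + c)
      \<and> Suc u = length (lock_events \<rho> c)"
    if q: "q < 2 * H" "enabled \<sigma> \<rho> (ev (q * L + m))" "\<not> hit q c" for q
  proof -
    have "TO_le \<sigma> (ev (q * L + c)) (ev (q * L + m))"
      using pos_less_N q cL c by (simp add: TO_le_\<sigma>)
    then have a: "ev (q * L + c) \<in> Events \<rho>"
      using q c by (auto simp: enabled_def)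
    have lk: "lk q c = c" using q by (simp add: lk_def)
    have "ev (q * L + c) \<in> set (lock_events \<rho> c)"
      using a cL c lk by (auto simp: lock_events_def op_Acq)
    then obtain u where u: "u < length (lock_events \<rho> c)" "lock_events \<rho> c ! u = ev (q * L + c)"
      by (auto simp: in_set_conv_nth)
    have "ev (q * L + m) \<notin> Events \<rho>" using q by (simp add: enabled_def)
    then have "Suc u = length (lock_events \<rho> c)"
      using held_lock_last[OF cr q(1) c _ a, of u] lk u by simp
    then show ?thesis using u by blast
  qed
  have "\<exists>u. lock_events \<rho> c ! u = ev (i * L + c) \<and> Suc u = length (lock_events \<rho> c)"
    using acq[of i] ij en no by auto
  moreover have "\<exists>u. lock_events \<rho> c ! u = ev ((H + j) * L + c) \<and> Suc u = length (lock_events \<rho> c)"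
    using acq[of "H + j"] ij en no by auto
  ultimately have "ev (i * L + c) = ev ((H + j) * L + c)"
    by (metis nat.inject)
  then have "i = H + j" by (metis cL(1) ev_inj pos_div)
  then show False using ij by simp
qed

lemma cover_if_race:
  assumes "has_osr_race \<sigma>"
  shows "\<exists>i<H. \<exists>j<H. \<forall>c<m. hit i c \<or> hit (H + j) c"
proof -
  obtain e1 e2 \<rho> where e: "e1 \<in> Events \<sigma>" "e2 \<in> Events \<sigma>" "conflicting e1 e2"
    and cr: "correct_reordering \<sigma> \<rho>" and en: "enabled \<sigma> \<rho> e1" "enabled \<sigma> \<rho> e2"
    using assms by (auto simp: has_osr_race_def osr_race_def opt_correct_reordering_def)
  obtain p1 p2 where p: "e1 = ev p1" "p1 < N" "e2 = ev p2" "p2 < N"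
    using e by (auto simp: set_\<sigma>)
  have w: "p1 mod L = m" "p2 mod L = m" "p1 \<noteq> p2"
    using e(3) p by (auto simp: conflicting_def op_Write)
  define q1 where "q1 = p1 div L"
  define q2 where "q2 = p2 div L"
  have q: "q1 < 2 * H" "q2 < 2 * H" "p1 = q1 * L + m" "p2 = q2 * L + m"
    using block_range p w div_mult_mod_eq[of p1 L] div_mult_mod_eq[of p2 L]
    by (auto simp: q1_def q2_def)
  \<comment> \<open>Within one thread the later write is enabled only if the earlier one has been
    executed, so two enabled writes belong to different threads.\<close>
  have "q1 div H \<noteq> q2 div H"
  proof
    assume "q1 div H = q2 div H"
    then have "TO_le \<sigma> e1 e2 \<or> TO_le \<sigma> e2 e1"
      using p by (auto simp: TO_le_\<sigma> q1_def q2_def)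
    then show False using en w p by (auto simp: enabled_def)
  qed
  moreover have "q1 div H < 2" "q2 div H < 2" using q by (auto simp: less_mult_imp_div_less)
  ultimately consider "q1 div H = 0" "q2 div H = 1" | "q1 div H = 1" "q2 div H = 0" by linarith
  then show ?thesis
  proof cases
    case 1
    then have "H \<le> q2" by (metis div_less not_less zero_neq_one)
    then have "q1 < H" "q2 = H + (q2 - H)" "q2 - H < H"
      using 1 q H_pos by (auto simp: div_eq_0_iff)
    then show ?thesis
      using race_imp_cover[OF cr, of q1 "q2 - H"] en p q by metis
  next
    case 2
    then have "H \<le> q1" by (metis div_less not_less zero_neq_one)
    then have "q2 < H" "q1 = H + (q1 - H)" "q1 - H < H"
      using 2 q H_pos by (auto simp: div_eq_0_iff)
    then show ?thesis
      using race_imp_cover[OF cr, of q2 "q1 - H"] en p q by metis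
  qed
qed

section \<open>From a covering pair of blocks to a race\<close>

context
  fixes i j :: nat
  assumes ij: "i < H" "j < H"
    and cover: "\<And>c. c < m \<Longrightarrow> hit i c \<or> hit (H + j) c"
begin

text \<open>\<open>X\<close> consists of the completed blocks of both threads, and \<open>Y\<close>
  of the acquires of the two open blocks. All of \<open>X\<close> precedes \<open>Y\<close>, so a
  lock held by an open block is never requested by a completed one.\<close>

definition X :: "nat list" where "X = [0..<i * L] @ [H * L..<(H + j) * L]"

definition Y :: "nat list" where
  "Y = [i * L..<i * L + m] @ [(H + j) * L..<(H + j) * L + m]"

definition \<rho> :: trace where "\<rho> = map ev (X @ Y)"

lemma i_before: "i * L + m < H * L"
proof -
  have "i * L + m < Suc i * L" by (simp add: L_def)
  also have "\<dots> \<le> H * L" using ij by (intro mult_le_mono1) simp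
  finally show ?thesis .
qed

lemma j_before: "(H + j) * L + m < N"
  using ij by (intro pos_less_N) (auto simp: L_def)

lemma mem_X: "p \<in> set X \<longleftrightarrow> p div L < i \<or> H \<le> p div L \<and> p div L < H + j"
  by (auto simp: X_def div_less_L[symmetric] less_eq_div_iff_mult_less_eq)

lemma mem_Y: "p \<in> set Y \<longleftrightarrow> (p div L = i \<or> p div L = H + j) \<and> p mod L < m"
proof -
  have "p \<in> {q * L..<q * L + m} \<longleftrightarrow> p div L = q \<and> p mod L < m" for q
  proof
    assume p: "p \<in> {q * L..<q * L + m}"
    define d where "d = p - q * L"
    have "p = q * L + d" "d < m" using p by (auto simp: d_def)
    moreover then have "d < L" by (simp add: L_def)
    ultimately show "p div L = q \<and> p mod L < m" by simp
  next
    assume "p div L = q \<and> p mod L < m"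
    moreover have "p = p div L * L + p mod L" by simp
    ultimately show "p \<in> {q * L..<q * L + m}" by (metis atLeastLessThan_iff le_add1 nat_add_left_cancel_less)
  qed
  then show ?thesis by (simp add: Y_def) blast
qed

lemma sorted_X: "sorted X" and sorted_Y: "sorted Y"
  using i_before ij by (auto simp: X_def Y_def sorted_append distrib_right)

lemma distinct_XY: "distinct (X @ Y)"
proof -
  have "p \<notin> set Y" if "p \<in> set X" for p
    using that ij by (auto simp: mem_X mem_Y)
  moreover have "distinct X" "distinct Y"
    using i_before ij by (auto simp: X_def Y_def distrib_right)
  ultimately show ?thesis by auto
qed

lemma XY_range: "p \<in> set (X @ Y) \<Longrightarrow> p < N"
  using j_before i_before by (auto simp: X_def Y_def distrib_right)

text \<open>This is where the covering is used: the open blocks have no common lock, so each lock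
  occurs at most once in \<open>Y\<close>, and only as an acquire.\<close>

lemma alternating_Y: "alternating l (lock_events (map ev Y) l)"
proof -
  define F where "F = filter (\<lambda>p. op_at p \<in> {Acq l, Rel l}) Y"
  have acq: "op_at p = Acq l \<and> p \<in> set Y" if "p \<in> set F" for p
    using that by (auto simp: F_def mem_Y op_Rel)
  have uniq: "p = p'" if "p \<in> set F" "p' \<in> set F" for p p'
  proof -
    have *: "p mod L < m" "p' mod L < m" "lk (p div L) (p mod L) = lk (p' div L) (p' mod L)"
      "p div L = i \<or> p div L = H + j" "p' div L = i \<or> p' div L = H + j"
      using acq[OF that(1)] acq[OF that(2)] by (auto simp: op_Acq mem_Y)
    have "p div L = p' div L"
      using * lk_two_threads[OF ij] cover by metis
    moreover then have "p mod L = p' mod L" using * lk_same_block by metis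
    ultimately show ?thesis by (metis div_mult_mod_eq)
  qed
  have "distinct F" using distinct_XY by (simp add: F_def)
  then have "length F = card (set F)" by (simp add: distinct_card)
  also have "\<dots> \<le> Suc 0" using uniq by (simp add: card_le_Suc0_iff_eq)
  finally have F: "length F \<le> Suc 0" .
  have "i = 0 \<and> op_at (F ! i) = Acq l" if "i < length F" for i
    using that F acq[OF nth_mem[OF that]] by linarith
  then have "\<forall>i<length (map ev F). i = 0 \<and> oper (map ev F ! i) = Acq l" by simp
  then show ?thesis
    unfolding lock_events_map F_def[symmetric] alternating_def by (metis even_zero)
qed

lemma wf_\<rho>: "wf_trace \<rho>"
proof -
  have "lock_events (map ev (X @ Y)) l = lock_events (map ev [0 * L..<i * L]) l
      @ lock_events (map ev [H * L..<(H + j) * L]) l @ lock_events (map ev Y) l" for l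
    by (simp add: X_def lock_events_def)
  \<comment> \<open>Both intervals of \<open>X\<close> consist of whole blocks, so their lock
    histories have even length and leave no lock held.\<close>
  then have "alternating l (lock_events (map ev (X @ Y)) l)" for l
    using alternating_blocks[of 0 i l] alternating_blocks[of H "H + j" l] alternating_Y
    by (simp only:) (intro alternating_append; simp)
  then show ?thesis using distinct_XY by (simp only: \<rho>_def wf_trace_map) simp
qed

lemma thread_of:
  shows "q div H = i div H \<Longrightarrow> q < H" "q < H \<Longrightarrow> q div H = 0" "i div H = 0"
    "H \<le> q \<Longrightarrow> q < 2 * H \<Longrightarrow> q div H = 1" "(H + j) div H = 1"
  using ij H_pos by (auto simp: div_eq_0_iff div_nat_eqI)

text \<open>A thread predecessor lies either in an earlier block, which is completed, or earlier in
  the same block. This serves closure, preservation of thread order and enabledness alike.\<close>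

lemma below_XY:
  assumes "p' \<le> p" "p' div L div H = p div L div H"
  shows "p \<in> set X \<Longrightarrow> p' \<in> set X" "p \<in> set Y \<Longrightarrow> p' \<in> set (X @ Y)"
    "p = i * L + m \<or> p = (H + j) * L + m \<Longrightarrow> p' \<noteq> p \<Longrightarrow> p' \<in> set (X @ Y)"
proof -
  have le: "p' div L \<le> p div L" using assms by (simp add: div_le_mono)
  have 1: "p' div L < H" if "p div L < H"
    using le that by simp
  have 2: "H \<le> p' div L" if "H \<le> p div L" "p div L < 2 * H"
  proof -
    have "p div L div H = 1" using that thread_of(4) by blast
    then show ?thesis using assms(2) thread_of(2)[of "p' div L"] by (metis not_less zero_neq_one)
  qed
  show X: "p \<in> set X \<Longrightarrow> p' \<in> set X"
    using le 1 2 ij by (fastforce simp: mem_X)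
  have main: "p' \<in> set (X @ Y)" if "p div L = i \<or> p div L = H + j" "p mod L \<le> m" "p' mod L < m \<or> p' div L \<noteq> p div L"
    using that(1)
  proof
    assume "p div L = i"
    then show ?thesis using that(3) le by (auto simp: mem_X mem_Y)
  next
    assume "p div L = H + j"
    then show ?thesis using that(3) le 2 ij by (auto simp: mem_X mem_Y)
  qed
  have md: "p' mod L \<le> p mod L" if "p' div L = p div L"
    using assms(1) that by (metis div_mult_mod_eq nat_add_left_cancel_le)
  show "p \<in> set Y \<Longrightarrow> p' \<in> set (X @ Y)"
    using main md unfolding mem_Y by fastforce
  assume p: "p = i * L + m \<or> p = (H + j) * L + m" and ne: "p' \<noteq> p"
  have "m < L" by (simp add: L_def)
  then have "p div L = i \<or> p div L = H + j" "p mod L = m" using p by auto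
  moreover have "p' mod L \<noteq> p mod L" if "p' div L = p div L"
    using ne that by (metis div_mult_mod_eq)
  ultimately show "p' \<in> set (X @ Y)"
    using main md by (metis le_neq_implies_less order_refl)
qed

lemma closed_\<rho>: "TO_rf_closed \<sigma> (Events \<rho>)"
  unfolding \<rho>_def set_map TO_rf_closed_\<sigma>
  using below_XY(1,2) XY_range by (auto; fastforce)

lemma correct_\<rho>: "correct_reordering \<sigma> \<rho>"
proof -
  have "TO_le \<rho> e1 e2" if t: "e1 \<in> Events \<rho>" "e2 \<in> Events \<rho>" "TO_le \<sigma> e1 e2" for e1 e2
  proof -
    obtain p1 p2 where p: "e1 = ev p1" "p1 \<in> set (X @ Y)" "e2 = ev p2" "p2 \<in> set (X @ Y)"
      using t(1,2) by (auto simp: \<rho>_def)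
    then have "p1 < N" "p2 < N" using XY_range by blast+
    then have le: "p1 div L div H = p2 div L div H" "p1 \<le> p2"
      using t p by (auto simp: TO_le_\<sigma>)
    have "tr_le \<rho> e1 e2"
    \<comment> \<open>\<open>X\<close> is closed under thread order by itself, so an event of
      \<open>Y\<close> never precedes one of \<open>X\<close> in its thread. On \<open>X\<close> and
      on \<open>Y\<close> separately, \<rho> follows the positions.\<close>
    proof (cases "p2 \<in> set X")
      case True
      then show ?thesis
        using below_XY(1)[OF le(2,1)] p le tr_le_sorted_prefix[OF distinct_XY sorted_X]
        by (simp add: \<rho>_def del: map_append)
    next
      case False
      then show ?thesis
        using p le tr_le_append[OF distinct_XY] tr_le_sorted_suffix[OF distinct_XY sorted_Y]
        by (auto simp add: \<rho>_def simp del: map_append)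
    qed
    then show ?thesis using le p by (simp add: TO_le_def)
  qed
  moreover have "Events \<rho> \<subseteq> Events \<sigma>"
    using XY_range by (auto simp: \<rho>_def set_\<sigma>)
  moreover have "\<not> is_read e" if "e \<in> Events \<rho>" for e
    using that by (auto simp: \<rho>_def is_read_def)
  ultimately show ?thesis
    using wf_\<rho> closed_\<rho> unfolding correct_reordering_def by blast
qed

text \<open>The match lies in the same block behind the write, and \<rho> contains such positions
  only for completed blocks.\<close>

lemma match_in_\<rho>:
  assumes "p \<in> set (X @ Y)" "p mod L < m" "match \<sigma> (ev p) = Some r"
  shows "r \<in> Events \<rho> \<longleftrightarrow> p \<in> set X"
proof -
  obtain p' where p': "r = ev p'" "p' div L = p div L" "p' mod L > m"
    using match_acquire[of p r] assms XY_range by blast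
  then have "r \<in> Events \<rho> \<longleftrightarrow> p' \<in> set X \<or> p' \<in> set Y" by (auto simp: \<rho>_def)
  moreover have "p' \<notin> set Y" using p' by (simp add: mem_Y)
  moreover have "p' \<in> set X \<longleftrightarrow> p \<in> set X" using p' by (simp add: mem_X)
  ultimately show ?thesis by blast
qed

text \<open>Both order conditions concern \<open>X\<close> alone: executed writes, and acquires
  whose release is executed, belong to completed blocks, and these are in the order of
  \<sigma>.\<close>

lemma optimistic_\<rho>: "opt_correct_reordering \<sigma> \<rho>"
proof -
  have ord: "tr_le \<rho> (ev p1) (ev p2) \<longleftrightarrow> tr_le \<sigma> (ev p1) (ev p2)" if "p1 \<in> set X" "p2 \<in> set X" for p1 p2
    using that tr_le_sorted_prefix[OF distinct_XY sorted_X that] XY_range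
    by (simp add: \<rho>_def tr_le_\<sigma> del: map_append)
  have "tr_le \<rho> e1 e2 \<longleftrightarrow> tr_le \<sigma> e1 e2"
    if t: "e1 \<in> Events \<rho>" "e2 \<in> Events \<rho>" "conflicting e1 e2" for e1 e2
  proof -
    obtain p1 p2 where p: "e1 = ev p1" "p1 \<in> set (X @ Y)" "e2 = ev p2" "p2 \<in> set (X @ Y)"
      using t(1,2) by (auto simp: \<rho>_def)
    then have "p1 \<in> set X" "p2 \<in> set X"
      using t(3) by (auto simp: conflicting_def op_Write mem_Y)
    then show ?thesis using ord p by simp
  qed
  moreover have "tr_le \<rho> a1 a2 \<longleftrightarrow> tr_le \<sigma> a1 a2"
    if t: "a1 \<in> Events \<rho>" "a2 \<in> Events \<rho>" "oper a1 = Acq l" "oper a2 = Acq l"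
      "match \<sigma> a1 = Some r1" "match \<sigma> a2 = Some r2" "r1 \<in> Events \<rho>" "r2 \<in> Events \<rho>"
    for a1 a2 l r1 r2
  proof -
    obtain p1 p2 where p: "a1 = ev p1" "p1 \<in> set (X @ Y)" "a2 = ev p2" "p2 \<in> set (X @ Y)"
      using t(1,2) by (auto simp: \<rho>_def)
    then have "p1 \<in> set X" "p2 \<in> set X"
      using t match_in_\<rho> by (auto simp: op_Acq)
    then show ?thesis using ord p by simp
  qed
  ultimately show ?thesis
    using correct_\<rho> unfolding opt_correct_reordering_def by blast
qed

lemma enabled_\<rho>:
  assumes "p = i * L + m \<or> p = (H + j) * L + m"
  shows "enabled \<sigma> \<rho> (ev p)"
proof -
  have pN: "p < N" using assms i_before j_before by (auto simp: distrib_right)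
  have "m < L" by (simp add: L_def)
  then have "p mod L = m" "p div L = i \<or> p div L = H + j" using assms by auto
  then have "p \<notin> set (X @ Y)" using ij by (auto simp: mem_X mem_Y)
  moreover have "e' \<in> Events \<rho>" if t: "e' \<noteq> ev p" "TO_le \<sigma> e' (ev p)" for e'
  proof -
    obtain p' where "e' = ev p'" "p' < N" using TO_le_events[OF t(2)] by (auto simp: set_\<sigma>)
    then show ?thesis
      using t pN below_XY(3)[of p' p] assms by (auto simp: TO_le_\<sigma> \<rho>_def)
  qed
  ultimately show ?thesis
    using pN by (auto simp: enabled_def \<rho>_def set_\<sigma>)
qed

lemma lock_closed_\<rho>:
  "opt_lock_closed \<sigma> (ev (i * L + m)) (ev ((H + j) * L + m)) (Events \<rho>)"
proof -
  have "f \<in> Events \<rho>" if t: "p = i * L + m \<or> p = (H + j) * L + m" "prev \<sigma> (ev p) = Some f" for p f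
  proof -
    have pN: "p < N" using t i_before j_before by (auto simp: distrib_right)
    obtain p' where "p' < p" "f = ev p'" "p' div L div H = p div L div H"
      using prev_\<sigma>[OF pN t(2)] by blast
    then show ?thesis
      using below_XY(3)[of p' p] t by (auto simp: \<rho>_def)
  qed
  moreover have "r \<in> Events \<rho>"
    if t: "a \<in> Events \<rho>" "is_acq a" "match \<sigma> a = Some r"
      "ev (i * L + m) \<notin> TRClosure \<sigma> r" "ev ((H + j) * L + m) \<notin> TRClosure \<sigma> r" for a r
  proof -
    obtain p where p: "a = ev p" "p \<in> set (X @ Y)"
      using t(1) by (auto simp: \<rho>_def)
    have pm: "p mod L < m" using t(2) p by (auto simp: is_acq_def op_Acq)
    obtain p' where p': "r = ev p'" "p' div L = p div L" "p' mod L > m" "p' < N"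
      using match_acquire[of p r] p pm t(3) XY_range by blast
    have mL: "m < L" by (simp add: L_def)
    have "p \<in> set X"
    proof (rule ccontr)
      assume "p \<notin> set X"
      then have "p div L = i \<or> p div L = H + j" using p by (auto simp: mem_Y)
      \<comment> \<open>A release of an open block has the racing write before it in its thread, so
        that write is in \<open>TRClosure \<sigma> r\<close>, contrary to the assumption.\<close>
      moreover have "TO_le \<sigma> (ev (q * L + m)) r" if "p div L = q" "q < 2 * H" for q
      proof -
        have "p' = q * L + p' mod L" using p' that by (metis div_mult_mod_eq)
        then have "q * L + m \<le> p'" using p' by linarith
        then show ?thesis
          using p' that pos_less_N[OF _ mL] mL by (simp add: TO_le_\<sigma>)
      qed
      ultimately show False using t(4,5) mem_TRClosure ij by fastforce
    qed
    then show ?thesis using match_in_\<rho> p pm t(3) by auto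
  qed
  ultimately show ?thesis
    using closed_\<rho> enabled_\<rho> unfolding opt_lock_closed_def enabled_def by (intro conjI) blast+
qed

lemma race_if_cover: "has_osr_race \<sigma>"
proof -
  have mL: "m < L" by (simp add: L_def)
  have "i * L + m \<noteq> (H + j) * L + m" using i_before by (simp add: distrib_right)
  moreover have "op_at (q * L + m) = Write 0" for q using mL by (simp add: op_Write)
  ultimately have "conflicting (ev (i * L + m)) (ev ((H + j) * L + m))"
    unfolding conflicting_def ev_simps ev_inj by blast
  then show ?thesis
    using optimistic_\<rho> lock_closed_\<rho> enabled_\<rho>
    unfolding has_osr_race_def osr_race_def by (metis enabled_def)
qed

end

theorem race_iff_cover:
  "has_osr_race \<sigma> \<longleftrightarrow> (\<exists>i<H. \<exists>j<H. \<forall>c<m. hit i c \<or> hit (H + j) c)"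
  using cover_if_race race_if_cover by blast

end

section \<open>Splitting assignments\<close>

text \<open>The block number \<open>q\<close> carries everything: \<open>q div 2 ^ h\<close> is the
  thread and at the same time the parity of the variables that it assigns, and bit
  \<open>x div 2\<close> of \<open>q\<close> is the value of variable \<open>x\<close>.\<close>

definition clause_hit :: "nat \<Rightarrow> cnf \<Rightarrow> nat \<Rightarrow> nat \<Rightarrow> bool" where
  "clause_hit h \<phi> q c \<longleftrightarrow> (\<exists>(x, b)\<in>set (\<phi> ! c). x mod 2 = q div 2 ^ h \<and> odd (q div 2 ^ (x div 2)) = b)"

lemma exists_binary: "\<exists>i::nat. i < 2 ^ h \<and> (\<forall>l<h. odd (i div 2 ^ l) = v l)"
proof (induction h arbitrary: v)
  case 0
  then show ?case by simp
next
  case (Suc h)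
  obtain i :: nat where i: "i < 2 ^ h" "\<And>l. l < h \<Longrightarrow> odd (i div 2 ^ l) = v (Suc l)"
    using Suc[of "\<lambda>l. v (Suc l)"] by blast
  define i' where "i' = 2 * i + of_bool (v 0)"
  have "i' < 2 ^ Suc h" using i by (auto simp: i'_def)
  moreover have "odd (i' div 2 ^ l) = v l" if "l < Suc h" for l
  proof (cases l)
    case (Suc l')
    have "i' div 2 = i" by (simp add: i'_def)
    then have "i' div 2 ^ l = i div 2 ^ l'" by (simp add: Suc div_mult2_eq)
    then show ?thesis using i that Suc by simp
  qed (simp add: i'_def)
  ultimately show ?case by blast
qed

text \<open>The added power contributes \<open>2 ^ (h - l)\<close> to the quotient, an even number
  as \<open>l < h\<close>. So the bit marking the second thread does not disturb the bits of the
  assignment.\<close>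

lemma odd_div_plus_power:
  assumes "l < h"
  shows "odd ((2 ^ h + j) div 2 ^ l) \<longleftrightarrow> odd ((j :: nat) div 2 ^ l)"
proof -
  have "(2 :: nat) ^ h = 2 ^ (h - l) * 2 ^ l" using assms by (simp flip: power_add)
  then have "(2 ^ h + j) div 2 ^ l = 2 ^ (h - l) + j div 2 ^ l" by simp
  then show ?thesis using assms by simp
qed

text \<open>The variables are split by parity; \<open>i\<close> and \<open>j\<close> encode the assignments of the even and
  of the odd ones.\<close>

lemma satisfiable_iff_cover:
  assumes range: "\<And>c x b. c \<in> set \<phi> \<Longrightarrow> (x, b) \<in> set c \<Longrightarrow> x < 2 * h"
  shows "satisfiable \<phi> \<longleftrightarrow> (\<exists>i<2 ^ h. \<exists>j<2 ^ h. \<forall>c<length \<phi>.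
     clause_hit h \<phi> i c \<or> clause_hit h \<phi> (2 ^ h + j) c)"
proof
  assume "satisfiable \<phi>"
  then obtain v where v: "\<And>c. c \<in> set \<phi> \<Longrightarrow> \<exists>(x, b)\<in>set c. v x = b"
    by (auto simp: satisfiable_def)
  obtain i :: nat where i: "i < 2 ^ h" "\<And>l. l < h \<Longrightarrow> odd (i div 2 ^ l) = v (2 * l)"
    using exists_binary[of h "\<lambda>l. v (2 * l)"] by blast
  obtain j :: nat where j: "j < 2 ^ h" "\<And>l. l < h \<Longrightarrow> odd (j div 2 ^ l) = v (2 * l + 1)"
    using exists_binary[of h "\<lambda>l. v (2 * l + 1)"] by blast
  have "clause_hit h \<phi> i c \<or> clause_hit h \<phi> (2 ^ h + j) c" if c: "c < length \<phi>" for c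
  proof -
    obtain x where x: "(x, v x) \<in> set (\<phi> ! c)" using v[OF nth_mem[OF c]] by auto
    then have l: "x div 2 < h" using range[OF nth_mem[OF c] x] by linarith
    show ?thesis
    proof (cases "even x")
      case True
      then have "2 * (x div 2) = x" by simp
      then have "odd (i div 2 ^ (x div 2)) = v x" using i(2)[OF l] by simp
      moreover have "x mod 2 = i div 2 ^ h" using i True by simp
      ultimately show ?thesis using x unfolding clause_hit_def by blast
    next
      case False
      then have "2 * (x div 2) + 1 = x" by simp
      then have "odd ((2 ^ h + j) div 2 ^ (x div 2)) = v x"
        using j(2)[OF l] odd_div_plus_power[OF l] by metis
      moreover have "x mod 2 = (2 ^ h + j) div 2 ^ h" using j False by (simp add: odd_iff_mod_2_eq_one)
      ultimately show ?thesis using x unfolding clause_hit_def by blast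
    qed
  qed
  then show "\<exists>i<2 ^ h. \<exists>j<2 ^ h. \<forall>c<length \<phi>.
     clause_hit h \<phi> i c \<or> clause_hit h \<phi> (2 ^ h + j) c"
    using i(1) j(1) by blast
next
  assume "\<exists>i<2 ^ h. \<exists>j<2 ^ h. \<forall>c<length \<phi>.
     clause_hit h \<phi> i c \<or> clause_hit h \<phi> (2 ^ h + j) c"
  then obtain i j :: nat where ij: "i < 2 ^ h" "j < 2 ^ h"
    "\<And>c. c < length \<phi> \<Longrightarrow> clause_hit h \<phi> i c \<or> clause_hit h \<phi> (2 ^ h + j) c"
    by blast
  define v where "v x = odd ((if even x then i else 2 ^ h + j) div 2 ^ (x div 2))" for x
  have side: "i div 2 ^ h = 0" "(2 ^ h + j) div 2 ^ h = 1" using ij by auto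
  have key: "v x = b"
    if "q = i \<or> q = 2 ^ h + j" "x mod 2 = q div 2 ^ h" "odd (q div 2 ^ (x div 2)) = b" for q x b
    using that(1)
  proof
    assume "q = i"
    then have "even x" using that(2) side(1) by (simp add: even_iff_mod_2_eq_zero)
    then show ?thesis using that(3) \<open>q = i\<close> by (simp add: v_def)
  next
    assume "q = 2 ^ h + j"
    then have "odd x" using that(2) side(2) by (simp add: odd_iff_mod_2_eq_one)
    then show ?thesis using that(3) \<open>q = 2 ^ h + j\<close> by (simp add: v_def)
  qed
  have "\<exists>(x, b)\<in>set (\<phi> ! c). v x = b" if c: "c < length \<phi>" for c
  proof -
    obtain q where q: "q = i \<or> q = 2 ^ h + j" "clause_hit h \<phi> q c" using ij(3)[OF c] by blast
    then obtain x b where "(x, b) \<in> set (\<phi> ! c)" "v x = b"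
      using key[OF q(1)] by (auto simp: clause_hit_def)
    then show ?thesis by blast
  qed
  then show "satisfiable \<phi>"
    unfolding satisfiable_def by (metis in_set_conv_nth)
qed

text \<open>Clauses are distinct lists of at most \<open>k\<close> out of \<open>2 * n\<close>
  literals. The base is raised to \<open>2 * n + 1\<close> so that its powers are monotone in the
  exponent even for \<open>n = 0\<close>.\<close>

lemma kcnf_length_bound:
  assumes "kcnf k n \<phi>"
  shows "length \<phi> \<le> (k + 1) * (2 * n + 1) ^ k"
proof -
  define A where "A = {..<n} \<times> (UNIV :: bool set)"
  have A: "finite A" "card A = 2 * n" by (auto simp: A_def card_cartesian_product)
  have "set \<phi> \<subseteq> {xs. set xs \<subseteq> A \<and> length xs \<le> k}"
    using assms by (fastforce simp: kcnf_def A_def)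
  moreover have "distinct \<phi>" using assms by (simp add: kcnf_def distinct_map)
  ultimately have "length \<phi> \<le> card {xs. set xs \<subseteq> A \<and> length xs \<le> k}"
    using card_mono[OF finite_lists_length_le[OF A(1)]] by (simp flip: distinct_card)
  also have "\<dots> = (\<Sum>i\<le>k. (2 * n) ^ i)" using card_lists_length_le[OF A(1)] A by simp
  also have "\<dots> \<le> (\<Sum>i\<le>k. (2 * n + 1) ^ k)"
  proof (intro sum_mono)
    fix i assume "i \<in> {..k}"
    have "(2 * n) ^ i \<le> (2 * n + 1) ^ i" by (intro power_mono) auto
    also have "\<dots> \<le> (2 * n + 1) ^ k" using \<open>i \<in> {..k}\<close> by (intro power_increasing) auto
    finally show "(2 * n) ^ i \<le> (2 * n + 1) ^ k" .
  qed
  finally show ?thesis by simp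
qed

section \<open>Programs with bounded word length\<close>

lemma bits_pos: "1 \<le> bits x"
  by (simp add: bits_def)

lemma bits_le_iff: "1 \<le> w \<Longrightarrow> bits x \<le> w \<longleftrightarrow> x < 2 ^ w"
  using floorlog_leD[of 2 x w] floorlog_leI[of x 2 w] by (auto simp: bits_def)

lemma less_power_bits: "x < 2 ^ bits x"
  using bits_le_iff[OF bits_pos] by blast

lemma bits_mono: "x \<le> y \<Longrightarrow> bits x \<le> bits y"
  by (meson bits_le_iff bits_pos le_less_trans less_power_bits)

lemma bits_mult: "bits (x * y) \<le> bits x + bits y"
  using mult_strict_mono[OF less_power_bits less_power_bits, of x y] bits_pos[of x]
  by (subst bits_le_iff) (auto simp: power_add)

text \<open>Already \<open>(x + 1) * (y + 1)\<close> exceeds \<open>x + y\<close>. The bound is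
  crude for a sum, but it is the one for products, so all four operations share it.\<close>

lemma bits_add: "bits (x + y) \<le> bits x + bits y"
proof -
  have "x + y < 2 ^ bits x * 2 ^ bits y"
  proof -
    have "Suc x * Suc y \<le> 2 ^ bits x * 2 ^ bits y"
      using less_power_bits[of x] less_power_bits[of y] by (intro mult_mono) (auto simp: Suc_le_eq)
    then show ?thesis by simp
  qed
  then show ?thesis using bits_pos[of x] by (subst bits_le_iff) (auto simp: power_add)
qed

lemma bits_le_Suc: "bits n \<le> Suc n"
  by (subst bits_le_iff) (auto intro: less_trans[OF less_exp])

lemma bits_arith_fun: "bits (arith_fun f x y) \<le> bits x + bits y"
proof (cases f)
  case Sub
  then show ?thesis using bits_mono[of "x - y" x] by simp
next
  case Div
  then show ?thesis using bits_mono[of "x div y" x] by simp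
qed (simp_all add: bits_add bits_mult)

text \<open>Storing a value is charged its length, so time \<open>t\<close> lengthens a cell by at
  most \<open>t\<close> bits. This controls the answer of an arbitrary race detector, of whose word
  length nothing is known.\<close>

lemma exec_bits: "exec p s t s' \<Longrightarrow> bits (s' a i) \<le> bits (s a i) + t"
proof (induction rule: exec.induct)
  case (Seq p s t s' q u s'')
  then show ?case by linarith
next
  case (WhileTrue e s p t s' u s'')
  then show ?case by linarith
qed auto

text \<open>The factor of \<open>w\<close> in a bound on the length of the value: a loaded cell fits
  into one word, and a constant \<open>n\<close> is estimated by \<open>bits n \<le> Suc n\<close>.
  Likewise \<open>esize\<close> is the factor in the evaluation cost.\<close>

fun vsize :: "expr \<Rightarrow> nat" where
  "vsize (Const n) = Suc n"
| "vsize (Load a e) = 1"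
| "vsize (Arith f e1 e2) = vsize e1 + vsize e2"

fun esize :: "expr \<Rightarrow> nat" where
  "esize (Const n) = Suc n"
| "esize (Load a e) = esize e + vsize e + 1"
| "esize (Arith f e1 e2) = esize e1 + esize e2 + vsize e1 + vsize e2"

text \<open>A loop counts as a single evaluation of its guard; its iterations are accounted for in
  \<open>loop_cost\<close>.\<close>

fun psize :: "prog \<Rightarrow> nat" where
  "psize Skip = 1"
| "psize (Store a e1 e2) = esize e1 + esize e2 + vsize e1 + vsize e2"
| "psize (Seq p q) = psize p + psize q"
| "psize (Cond e p q) = esize e + vsize e + psize p + psize q"
| "psize (While e p) = esize e + vsize e"

definition word_bounded :: "nat \<Rightarrow> memory \<Rightarrow> bool" where
  "word_bounded w s \<longleftrightarrow> (\<forall>a i. bits (s a i) \<le> w)"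

lemma word_bounded_pos: "word_bounded w s \<Longrightarrow> 1 \<le> w"
  using bits_pos order_trans by (fastforce simp: word_bounded_def)

lemma le_mult_word: "word_bounded w s \<Longrightarrow> x \<le> x * w"
  using word_bounded_pos[of w s] by (cases w) auto

lemma bits_val: assumes "word_bounded w s" shows "bits (val e s) \<le> vsize e * w"
proof (induction e)
  case (Const n)
  then show ?case using bits_le_Suc[of n] le_mult_word[OF assms, of "Suc n"] by simp
next
  case (Load a e)
  then show ?case using assms by (simp add: word_bounded_def)
next
  case (Arith f e1 e2)
  then show ?case using bits_arith_fun[of f "val e1 s" "val e2 s"]
    by (simp add: distrib_right)
qed

lemma expr_cost_le: assumes "word_bounded w s" shows "expr_cost e s \<le> esize e * w"
proof (induction e)
  case (Const n)
  then show ?case using bits_le_Suc[of n] le_mult_word[OF assms, of "Suc n"] by simp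
next
  case (Load a e)
  moreover have "bits (s a (val e s)) \<le> w" using assms by (simp add: word_bounded_def)
  ultimately show ?case using bits_val[OF assms, of e] by (simp add: distrib_right)
next
  case (Arith f e1 e2)
  then show ?case using bits_val[OF assms, of e1] bits_val[OF assms, of e2]
    by (simp add: distrib_right)
qed

text \<open>Costs are counted in units of the word length \<open>w\<close>; then the cost of a loop-free program
  is bounded by its syntactic size alone.\<close>

definition runs :: "nat \<Rightarrow> prog \<Rightarrow> nat \<Rightarrow> memory \<Rightarrow> (memory \<Rightarrow> bool) \<Rightarrow> bool" where
  "runs w p T s Q \<longleftrightarrow> (word_bounded w s \<longrightarrow>
     (\<exists>t s'. exec p s t s' \<and> t \<le> T * w \<and> word_bounded w s' \<and> Q s'))"

lemma runs_mono: "runs w p T s Q \<Longrightarrow> T \<le> T' \<Longrightarrow> (\<And>s'. Q s' \<Longrightarrow> Q' s') \<Longrightarrow> runs w p T' s Q'"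
  unfolding runs_def by (meson mult_le_mono1 order_trans)

lemma runs_store:
  assumes "val e2 s < 2 ^ w" "Q (s(a := (s a)(val e1 s := val e2 s)))"
  shows "runs w (Store a e1 e2) (psize (Store a e1 e2)) s Q"
  unfolding runs_def
proof (intro impI exI conjI)
  assume b: "word_bounded w s"
  show "exec (Store a e1 e2) s
      (expr_cost e1 s + expr_cost e2 s + bits (val e1 s) + bits (val e2 s))
      (s(a := (s a)(val e1 s := val e2 s)))" by (rule exec.Store)
  show "expr_cost e1 s + expr_cost e2 s + bits (val e1 s) + bits (val e2 s)
      \<le> psize (Store a e1 e2) * w"
    using expr_cost_le[OF b, of e1] expr_cost_le[OF b, of e2] bits_val[OF b, of e1]
      bits_val[OF b, of e2] by (simp add: distrib_right)
  show "word_bounded w (s(a := (s a)(val e1 s := val e2 s)))"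
    using b assms(1) bits_le_iff[OF word_bounded_pos[OF b]] by (simp add: word_bounded_def)
qed (rule assms(2))

text \<open>The run of the second program is the postcondition of the first, so sequences are
  executed symbolically without naming intermediate memories.\<close>

lemma runs_seq:
  assumes "runs w p T s (\<lambda>s'. runs w q U s' Q)"
  shows "runs w (Seq p q) (T + U) s Q"
  unfolding runs_def
proof
  assume "word_bounded w s"
  then obtain t s' u s'' where "exec p s t s'" "t \<le> T * w" "exec q s' u s''" "u \<le> U * w"
    "word_bounded w s''" "Q s''"
    using assms unfolding runs_def by blast
  then show "\<exists>t s'. exec (Seq p q) s t s' \<and> t \<le> (T + U) * w \<and> word_bounded w s' \<and> Q s'"
    by (intro exI[of _ "t + u"] exI[of _ s'']) (auto intro: exec.Seq simp: distrib_right)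
qed

lemma runs_seq_then:
  "runs w p T s P \<Longrightarrow> (\<And>s'. P s' \<Longrightarrow> runs w q U s' Q) \<Longrightarrow> runs w (Seq p q) (T + U) s Q"
  by (intro runs_seq) (rule runs_mono[OF _ order_refl])

text \<open>With all costs fixed to \<open>psize\<close> the rule applies backwards without unknown
  summands; it drives the loop-free code.\<close>

lemma runs_seq_psize:
  "runs w p (psize p) s (\<lambda>s'. runs w q (psize q) s' Q) \<Longrightarrow> runs w (Seq p q) (psize (Seq p q)) s Q"
  using runs_seq by simp

lemma runs_cond:
  assumes "val e s \<noteq> 0 \<Longrightarrow> runs w p (psize p) s Q" "val e s = 0 \<Longrightarrow> runs w q (psize q) s Q"
  shows "runs w (Cond e p q) (psize (Cond e p q)) s Q"
  unfolding runs_def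
proof
  assume b: "word_bounded w s"
  have c: "expr_cost e s + bits (val e s) \<le> (esize e + vsize e) * w"
    using expr_cost_le[OF b, of e] bits_val[OF b, of e] by (simp add: distrib_right)
  show "\<exists>t s'. exec (Cond e p q) s t s' \<and> t \<le> psize (Cond e p q) * w \<and> word_bounded w s' \<and> Q s'"
  proof (cases "val e s = 0")
    case True
    then obtain t s' where "exec q s t s'" "t \<le> psize q * w" "word_bounded w s'" "Q s'"
      using assms(2) b unfolding runs_def by blast
    with c True exec.CondFalse[of e s q t s' p] show ?thesis
      by (intro exI[of _ "expr_cost e s + bits (val e s) + t"] exI[of _ s'])
        (auto simp: distrib_right)
  next
    case False
    then obtain t s' where "exec p s t s'" "t \<le> psize p * w" "word_bounded w s'" "Q s'"
      using assms(1) b unfolding runs_def by blast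
    with c False show ?thesis
      by (intro exI[of _ "expr_cost e s + bits (val e s) + t"] exI[of _ s'])
        (auto intro: exec.CondTrue simp: distrib_right)
  qed
qed

abbreviation loop_cost :: "nat \<Rightarrow> nat \<Rightarrow> expr \<Rightarrow> prog \<Rightarrow> nat" where
  "loop_cost n T e p \<equiv> n * (T + psize (While e p)) + psize (While e p)"

lemma runs_while:
  assumes init: "I 0 s"
    and step: "\<And>k s. k < n \<Longrightarrow> I k s \<Longrightarrow> val e s \<noteq> 0 \<and> runs w p T s (I (Suc k))"
    and exit: "\<And>s. I n s \<Longrightarrow> val e s = 0"
  shows "runs w (While e p) (loop_cost n T e p) s (I n)"
proof -
  have guard: "expr_cost e s + bits (val e s) \<le> psize (While e p) * w" if "word_bounded w s" for s
    using expr_cost_le[OF that, of e] bits_val[OF that, of e] by (simp add: distrib_right)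
  \<comment> \<open>Induction on the number \<open>d\<close> of iterations still to come. The
    summand outside the product pays for the final, failing guard.\<close>
  have "runs w (While e p) (d * (T + psize (While e p)) + psize (While e p)) s (I n)"
    if "I (n - d) s" "d \<le> n" for d s
    using that
  proof (induction d arbitrary: s)
    case 0
    then have "exec (While e p) s (expr_cost e s + bits (val e s)) s"
      using exec.WhileFalse[of e s p] exit[of s] by simp
    then show ?case using 0 guard unfolding runs_def by auto
  next
    case (Suc d)
    show ?case unfolding runs_def
    proof
      assume b: "word_bounded w s"
      have "val e s \<noteq> 0" and r: "runs w p T s (I (n - d))"
        using step[of "n - Suc d" s] Suc.prems by (auto simp: Suc_diff_Suc)
      from r b obtain t s' where s': "exec p s t s'" "t \<le> T * w" "word_bounded w s'" "I (n - d) s'"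
        unfolding runs_def by blast
      with Suc obtain u s'' where s'': "exec (While e p) s' u s''"
        "u \<le> (d * (T + psize (While e p)) + psize (While e p)) * w" "word_bounded w s''" "I n s''"
        unfolding runs_def by (meson Suc_leD)
      have "exec (While e p) s (expr_cost e s + bits (val e s) + t + u) s''"
        using \<open>val e s \<noteq> 0\<close> s' s'' by (intro exec.WhileTrue)
      moreover have "expr_cost e s + bits (val e s) + t + u
          \<le> (Suc d * (T + psize (While e p)) + psize (While e p)) * w"
        using guard[OF b] s' s'' by (simp add: distrib_right)
      ultimately show "\<exists>t s'. exec (While e p) s t s'
          \<and> t \<le> (Suc d * (T + psize (While e p)) + psize (While e p)) * w
          \<and> word_bounded w s' \<and> I n s'"
        using s'' by blast
    qed
  qed
  from this[of n s] init show ?thesis by simp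
qed

section \<open>Relocating a program to other arrays\<close>

fun shift_expr :: "nat \<Rightarrow> expr \<Rightarrow> expr" where
  "shift_expr d (Const n) = Const n"
| "shift_expr d (Load a e) = Load (a + d) (shift_expr d e)"
| "shift_expr d (Arith f e1 e2) = Arith f (shift_expr d e1) (shift_expr d e2)"

text \<open>Relocation by 4 frees arrays 0 to 3 for the generator and makes its output array 4 the
  input array of the race detector.\<close>

fun shift_prog :: "nat \<Rightarrow> prog \<Rightarrow> prog" where
  "shift_prog d Skip = Skip"
| "shift_prog d (Store a e1 e2) = Store (a + d) (shift_expr d e1) (shift_expr d e2)"
| "shift_prog d (Seq p q) = Seq (shift_prog d p) (shift_prog d q)"
| "shift_prog d (Cond e p q) = Cond (shift_expr d e) (shift_prog d p) (shift_prog d q)"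
| "shift_prog d (While e p) = While (shift_expr d e) (shift_prog d p)"

lemma val_shift: "val (shift_expr d e) s = val e (\<lambda>a. s (a + d))"
  by (induction e) auto

lemma expr_cost_shift: "expr_cost (shift_expr d e) s = expr_cost e (\<lambda>a. s (a + d))"
  by (induction e) (auto simp: val_shift)

text \<open>Array names are free of charge: costs depend only on addresses and values, so the
  relocated program takes exactly the same time.\<close>

lemma exec_shift:
  "exec p s t s' \<Longrightarrow> (\<lambda>a. r (a + d)) = s \<Longrightarrow>
     \<exists>r'. exec (shift_prog d p) r t r' \<and> (\<lambda>a. r' (a + d)) = s'"
proof (induction arbitrary: r rule: exec.induct)
  case (Skip s)
  then show ?case by (metis exec.Skip shift_prog.simps(1))
next
  case (Store a e1 e2 s)
  let ?r' = "r(a + d := (r (a + d))(val e1 s := val e2 s))"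
  have "exec (shift_prog d (Store a e1 e2)) r
     (expr_cost e1 s + expr_cost e2 s + bits (val e1 s) + bits (val e2 s)) ?r'"
    using exec.Store[of "a + d" "shift_expr d e1" "shift_expr d e2" r] Store
    by (simp add: val_shift expr_cost_shift)
  moreover have "(\<lambda>a. ?r' (a + d)) = s(a := (s a)(val e1 s := val e2 s))"
    using Store by (auto simp: fun_eq_iff)
  ultimately show ?case by blast
next
  case (Seq p s t s' q u s'')
  then show ?case by (metis exec.Seq shift_prog.simps(3))
next
  case (CondTrue e s p t s' q)
  then obtain r' where "exec (shift_prog d p) r t r'" "(\<lambda>a. r' (a + d)) = s'" by blast
  then show ?case
    using exec.CondTrue[of "shift_expr d e" r "shift_prog d p" t r' "shift_prog d q"] CondTrue
    by (auto simp: val_shift expr_cost_shift)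
next
  case (CondFalse e s q t s' p)
  then obtain r' where "exec (shift_prog d q) r t r'" "(\<lambda>a. r' (a + d)) = s'" by blast
  then show ?case
    using exec.CondFalse[of "shift_expr d e" r "shift_prog d q" t r' "shift_prog d p"] CondFalse
    by (auto simp: val_shift expr_cost_shift)
next
  case (WhileFalse e s p)
  then show ?case
    using exec.WhileFalse[of "shift_expr d e" r "shift_prog d p"]
    by (auto simp: val_shift expr_cost_shift)
next
  case (WhileTrue e s p t s' u s'')
  then obtain r' r'' where "exec (shift_prog d p) r t r'" "(\<lambda>a. r' (a + d)) = s'"
    "exec (shift_prog d (While e p)) r' u r''" "(\<lambda>a. r'' (a + d)) = s''" by blast
  then show ?case
    using exec.WhileTrue[of "shift_expr d e" r "shift_prog d p" t r' u r''] WhileTrue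
    by (auto simp: val_shift expr_cost_shift)
qed

section \<open>A program writing the trace of a formula\<close>

lemma nth_concat_uniform:
  "\<forall>xs\<in>set xss. length xs = d \<Longrightarrow> p < length xss \<Longrightarrow> r < d \<Longrightarrow> concat xss ! (d * p + r) = xss ! p ! r"
proof (induction xss arbitrary: p)
  case (Cons xs xss)
  then show ?case by (cases p) (auto simp: nth_append)
qed simp

lemma length_concat_uniform: "\<forall>xs\<in>set xss. length xs = d \<Longrightarrow> length (concat xss) = d * length xss"
  by (induction xss) auto

abbreviation add_expr (infixl "+\<^sub>e" 65) where "a +\<^sub>e b \<equiv> Arith Add a b"
abbreviation sub_expr (infixl "-\<^sub>e" 65) where "a -\<^sub>e b \<equiv> Arith Sub a b"
abbreviation mul_expr (infixl "*\<^sub>e" 70) where "a *\<^sub>e b \<equiv> Arith Mul a b"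
abbreviation div_expr (infixl "div\<^sub>e" 70) where "a div\<^sub>e b \<equiv> Arith Div a b"

text \<open>Array 0 holds the formula, array 2 the scalar variables, array 3 the powers of 2, and
  array 4 receives the trace.\<close>

abbreviation (input) "vHalf \<equiv> 12 :: nat"
abbreviation (input) "vBlocks \<equiv> 11 :: nat"
abbreviation (input) "vClauses \<equiv> 2 :: nat"
abbreviation (input) "vPtr \<equiv> 3 :: nat"
abbreviation (input) "vClause \<equiv> 4 :: nat"
abbreviation (input) "vBlock \<equiv> 5 :: nat"
abbreviation (input) "vFlag \<equiv> 6 :: nat"
abbreviation (input) "vLit \<equiv> 7 :: nat"
abbreviation (input) "vLock \<equiv> 8 :: nat"
abbreviation (input) "vPos \<equiv> 9 :: nat"
abbreviation (input) "vExp \<equiv> 10 :: nat"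

abbreviation var :: "nat \<Rightarrow> expr" where "var v \<equiv> Load 2 (Const v)"
abbreviation assign :: "nat \<Rightarrow> expr \<Rightarrow> prog" where "assign v e \<equiv> Store 2 (Const v) e"
abbreviation seq (infixr ";;" 60) where "p ;; q \<equiv> Seq p q"

definition parity :: "expr \<Rightarrow> expr" where
  "parity e = e -\<^sub>e Const 2 *\<^sub>e (e div\<^sub>e Const 2)"

lemma val_parity [simp]: "val (parity e) s = val e s mod 2"
  by (simp add: parity_def minus_mult_div_eq_mod)

text \<open>Cell 0 of the input array is the length of the word, so n is in cell 1, the number of
  clauses in cell 2, and the clauses start in cell 3.\<close>

definition power_start :: prog where
  "power_start = (assign vHalf ((Load 0 (Const 1) +\<^sub>e Const 1) div\<^sub>e Const 2) ;;
     Store 3 (Const 0) (Const 1) ;; assign vExp (Const 0))"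

definition power_guard :: expr where
  "power_guard = var vHalf -\<^sub>e var vExp"

definition power_body :: prog where
  "power_body = (Store 3 (var vExp +\<^sub>e Const 1) (Const 2 *\<^sub>e Load 3 (var vExp)) ;;
     assign vExp (var vExp +\<^sub>e Const 1))"

definition code_expr :: expr where
  "code_expr = Load 0 (var vPtr +\<^sub>e Const 1 +\<^sub>e var vLit)"

text \<open>Adding 1 turns the parity of a sum into an equality test of parities.\<close>

definition literal_expr :: expr where
  "literal_expr =
     parity (code_expr div\<^sub>e Const 2 +\<^sub>e var vBlock div\<^sub>e var vBlocks +\<^sub>e Const 1) *\<^sub>e
     parity (var vBlock div\<^sub>e Load 3 (code_expr div\<^sub>e Const 4) +\<^sub>e code_expr +\<^sub>e Const 1)"

definition literal_body :: prog where
  "literal_body = (assign vFlag (var vFlag +\<^sub>e literal_expr) ;; assign vLit (var vLit +\<^sub>e Const 1))"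

definition literal_guard :: expr where
  "literal_guard = Load 0 (var vPtr) -\<^sub>e var vLit"

text \<open>Event \<open>p\<close> occupies cells \<open>4 * p + 1\<close> to
  \<open>4 * p + 4\<close>, as cell 0 is reserved for the length. Random access permits writing the
  events in any order.\<close>

definition emit :: "nat \<Rightarrow> expr \<Rightarrow> prog" where
  "emit opc e = (Store 4 (Const 4 *\<^sub>e var vPos +\<^sub>e Const 1) (var vPos) ;;
     Store 4 (Const 4 *\<^sub>e var vPos +\<^sub>e Const 2) (var vBlock div\<^sub>e var vBlocks) ;;
     Store 4 (Const 4 *\<^sub>e var vPos +\<^sub>e Const 3) (Const opc) ;;
     Store 4 (Const 4 *\<^sub>e var vPos +\<^sub>e Const 4) e)"

definition pos_expr :: "expr \<Rightarrow> expr" where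
  "pos_expr e = var vBlock *\<^sub>e (Const 2 *\<^sub>e var vClauses +\<^sub>e Const 1) +\<^sub>e e"

definition block_start :: prog where
  "block_start = (assign vFlag (Const 0) ;; assign vLit (Const 0))"

text \<open>The acquire and its mirrored release are written together, so each clause is evaluated
  once per block.\<close>

definition block_end :: prog where
  "block_end =
     (Cond (var vFlag)
       (assign vLock (var vClauses +\<^sub>e var vClause +\<^sub>e var vClauses *\<^sub>e (var vBlock div\<^sub>e var vBlocks)))
       (assign vLock (var vClause)) ;;
     assign vPos (pos_expr (var vClause)) ;; emit 2 (var vLock) ;;
     assign vPos (pos_expr (Const 2 *\<^sub>e var vClauses -\<^sub>e var vClause)) ;; emit 3 (var vLock) ;;
     assign vBlock (var vBlock +\<^sub>e Const 1))"

definition block_body :: prog where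
  "block_body = (block_start ;; While literal_guard literal_body ;; block_end)"

definition block_guard :: expr where
  "block_guard = Const 2 *\<^sub>e var vBlocks -\<^sub>e var vBlock"

definition clause_end :: prog where
  "clause_end = (assign vPtr (var vPtr +\<^sub>e Load 0 (var vPtr) +\<^sub>e Const 1) ;;
     assign vClause (var vClause +\<^sub>e Const 1))"

definition clause_guard :: expr where
  "clause_guard = var vClauses -\<^sub>e var vClause"

text \<open>Clauses vary in length, so their addresses are found by advancing a pointer. With
  clauses in the outer loop it moves once per clause, while all blocks are served in
  between.\<close>

definition clause_body :: prog where
  "clause_body = (assign vBlock (Const 0) ;; While block_guard block_body ;; clause_end)"

definition write_body :: prog where
  "write_body = (assign vPos (pos_expr (var vClauses)) ;; emit 1 (Const 0) ;;
     assign vBlock (var vBlock +\<^sub>e Const 1))"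

definition prepare :: prog where
  "prepare = (assign vBlocks (Load 3 (var vHalf)) ;; assign vClauses (Load 0 (Const 2)) ;;
     assign vPtr (Const 3) ;; assign vClause (Const 0))"

text \<open>The length of the encoded trace: four cells for each of the
  \<open>2 * B * (2 * m + 1)\<close> events.\<close>

definition finish :: prog where
  "finish = Store 4 (Const 0) (Const 8 *\<^sub>e var vBlocks *\<^sub>e (Const 2 *\<^sub>e var vClauses +\<^sub>e Const 1))"

definition generate :: prog where
  "generate = (power_start ;; While power_guard power_body ;; prepare ;;
     While clause_guard clause_body ;; assign vBlock (Const 0) ;;
     While block_guard write_body ;; finish)"

section \<open>Correctness of the generator\<close>

locale sat_reduction =
  fixes n k :: nat and \<phi> :: cnf
  assumes kcnf: "kcnf k n \<phi>"
begin

text \<open>Rounded up, so that every variable finds its bit in one of the halves; for odd n the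
  second half has one idle bit.\<close>

definition h :: nat where "h = (n + 1) div 2"

abbreviation "m \<equiv> length \<phi>"

abbreviation "B \<equiv> (2 :: nat) ^ h"

sublocale block_trace m B "clause_hit h \<phi>"
  by unfold_locales simp

text \<open>Every value that the generator stores must stay below \<open>2 ^ w\<close>. The summands
  \<open>n + m + 4\<close> cover the length \<open>4 * N\<close> of the encoded trace, and
  \<open>m + k + 3\<close> covers the addresses \<open>3 + m * (k + 1)\<close> in the input.\<close>

definition w :: nat where "w = n + m + k + 4"

definition inp :: "nat \<Rightarrow> nat" where "inp = input_memory (encode_cnf (n, \<phi>)) 0"

definition out :: "nat \<Rightarrow> nat" where "out = input_memory (encode_trace \<sigma>) 0"

abbreviation enc_clause :: "clause \<Rightarrow> nat list" where
  "enc_clause c \<equiv> length c # map encode_literal c"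

definition start :: "nat \<Rightarrow> nat" where
  "start c = 3 + length (concat (map enc_clause (take c \<phi>)))"

lemma clause_length: "c < m \<Longrightarrow> length (\<phi> ! c) \<le> k"
  using kcnf nth_mem unfolding kcnf_def by blast

lemma literal_range: "c < m \<Longrightarrow> j < length (\<phi> ! c) \<Longrightarrow> fst (\<phi> ! c ! j) < n"
  using kcnf nth_mem unfolding kcnf_def by fastforce

lemma start_0: "start 0 = 3"
  by (simp add: start_def)

lemma start_Suc: "c < m \<Longrightarrow> start (Suc c) = start c + length (\<phi> ! c) + 1"
  by (simp add: start_def take_Suc_conv_app_nth)

lemma start_le: "c \<le> m \<Longrightarrow> start c \<le> 3 + c * (k + 1)"
proof (induction c)
  case (Suc c)
  then show ?case using start_Suc[of c] clause_length[of c] by simp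
qed (simp add: start_0)

lemma inp_simps:
  "inp (Suc 0) = n" "inp 2 = m"
  "c < m \<Longrightarrow> inp (start c) = length (\<phi> ! c)"
  "c < m \<Longrightarrow> j < length (\<phi> ! c) \<Longrightarrow> inp (start c + 1 + j) = encode_literal (\<phi> ! c ! j)"
proof -
  define ys where "ys = concat (map enc_clause \<phi>)"
  have inp: "inp (Suc i) = (n # m # ys) ! i" if "i < Suc (Suc (length ys))" for i
    using that by (simp add: inp_def input_memory_def encode_cnf_def ys_def)
  show "inp (Suc 0) = n" "inp 2 = m"
    using inp[of 0] inp[of 1] by (simp_all add: numeral_2_eq_2)
  have "inp (start c + j) = enc_clause (\<phi> ! c) ! j" if "c < m" "j \<le> length (\<phi> ! c)" for c j
  proof -
    define us where "us = concat (map enc_clause (take c \<phi>))"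
    have "\<phi> = take c \<phi> @ \<phi> ! c # drop (Suc c) \<phi>"
      using that by (simp add: id_take_nth_drop[symmetric])
    from arg_cong[OF this, of "\<lambda>\<psi>. concat (map enc_clause \<psi>)"]
    have ys: "ys = us @ enc_clause (\<phi> ! c) @ concat (map enc_clause (drop (Suc c) \<phi>))"
      by (simp add: ys_def us_def)
    have "inp (start c + j) = inp (Suc (Suc (Suc (length us + j))))"
      by (simp add: start_def us_def numeral_3_eq_3)
    also have "\<dots> = ys ! (length us + j)"
      using inp[of "Suc (Suc (length us + j))"] that(2) by (simp add: ys)
    also have "\<dots> = enc_clause (\<phi> ! c) ! j"
      using that(2) unfolding ys nth_append_length_plus by (subst nth_append) simp
    finally show ?thesis .
  qed
  from this[of c 0] this[of c "Suc j"]
  show "c < m \<Longrightarrow> inp (start c) = length (\<phi> ! c)"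
    "c < m \<Longrightarrow> j < length (\<phi> ! c) \<Longrightarrow> inp (start c + 1 + j) = encode_literal (\<phi> ! c ! j)"
    by simp_all
qed

lemma encode_trace_nth:
  "length (encode_trace \<sigma>) = 4 * N"
  "p < N \<Longrightarrow> r < 4 \<Longrightarrow> encode_trace \<sigma> ! (4 * p + r) =
     [p, p div L div B, opcode (op_at p), operand (op_at p)] ! r"
proof -
  let ?f = "\<lambda>e. [ident e, th e, opcode (oper e), operand (oper e)]"
  have u: "\<forall>xs\<in>set (map ?f \<sigma>). length xs = 4" by auto
  have l: "length (map ?f \<sigma>) = N" by (simp add: \<sigma>_def)
  show "length (encode_trace \<sigma>) = 4 * N"
    using length_concat_uniform[OF u] l by (simp add: encode_trace_def)
  assume "p < N" "r < 4"
  then show "encode_trace \<sigma> ! (4 * p + r) =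
     [p, p div L div B, opcode (op_at p), operand (op_at p)] ! r"
    using nth_concat_uniform[OF u, of p r] l unfolding encode_trace_def
    by (simp add: \<sigma>_def)
qed

lemma out_simps:
  "out 0 = 4 * N"
  "p < N \<Longrightarrow> out (4 * p + 1) = p"
  "p < N \<Longrightarrow> out (4 * p + 2) = p div L div B"
  "p < N \<Longrightarrow> out (4 * p + 3) = opcode (op_at p)"
  "p < N \<Longrightarrow> out (4 * p + 4) = operand (op_at p)"
  "i > 4 * N \<Longrightarrow> out i = 0"
proof -
  have "out (Suc (4 * p + r)) = [p, p div L div B, opcode (op_at p), operand (op_at p)] ! r"
    if "p < N" "r < 4" for p r
    using that encode_trace_nth(2)[OF that]
    by (simp add: out_def input_memory_def encode_trace_nth(1))
  from this[of p 0] this[of p 1] this[of p 2] this[of p 3]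
  show "p < N \<Longrightarrow> out (4 * p + 1) = p" "p < N \<Longrightarrow> out (4 * p + 2) = p div L div B"
    "p < N \<Longrightarrow> out (4 * p + 3) = opcode (op_at p)" "p < N \<Longrightarrow> out (4 * p + 4) = operand (op_at p)"
    by (simp_all add: numeral_eq_Suc)
  show "out 0 = 4 * N" "i > 4 * N \<Longrightarrow> out i = 0"
    by (simp_all add: out_def input_memory_def encode_trace_nth(1))
qed

lemma B_le: "B \<le> 2 ^ n"
  by (intro power_increasing) (auto simp: h_def)

lemma Suc_le_power: "Suc x \<le> 2 ^ x"
  by (simp add: Suc_leI less_exp)

lemma four_N_less: "4 * N < 2 ^ w"
proof -
  have "L < 2 * Suc m" by (simp add: L_def)
  also have "\<dots> \<le> 2 * 2 ^ m" by (intro mult_le_mono2 Suc_le_power)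
  finally have "B * L < 2 ^ n * (2 * 2 ^ m)"
    using B_le by (intro mult_le_less_imp_less) auto
  then have "8 * (B * L) < 8 * (2 ^ n * (2 * 2 ^ m))" by linarith
  also have "\<dots> = 2 ^ (n + m + 4)" by (simp add: power_add)
  finally have "4 * N < 2 ^ (n + m + 4)" by (simp add: N_def mult.assoc)
  also have "\<dots> \<le> 2 ^ w" by (intro power_increasing) (auto simp: w_def)
  finally show ?thesis .
qed

lemma le_N_bounded: "x \<le> 4 * N \<Longrightarrow> x < 2 ^ w"
  using four_N_less by linarith

lemma small_bounded:
  "n < 2 ^ w" "m < 2 ^ w" "k < 2 ^ w" "3 + m * (k + 1) < 2 ^ w" "2 * n < 2 ^ w" "4 < (2::nat) ^ w"
proof -
  have le: "(2 :: nat) ^ x \<le> 2 ^ w" if "x \<le> w" for x using that by (intro power_increasing) auto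
  have "m * (k + 1) \<le> 2 ^ m * 2 ^ k"
    using Suc_le_power[of m] Suc_le_power[of k] by (intro mult_mono) auto
  also have "\<dots> = 2 ^ (m + k)" by (simp add: power_add)
  finally have "m * (k + 1) \<le> 2 ^ (m + k)" .
  moreover have "(1 :: nat) \<le> 2 ^ (m + k)" by simp
  moreover have "(2 :: nat) ^ (m + k + 3) = 8 * 2 ^ (m + k)" by (simp add: power_add)
  ultimately have "3 + m * (k + 1) < 2 ^ (m + k + 3)" by linarith
  then show "3 + m * (k + 1) < 2 ^ w" by (rule less_le_trans[OF _ le]) (simp add: w_def)
  have "2 * n < 2 ^ Suc n" using less_exp[of n] by simp
  then show "2 * n < 2 ^ w" by (rule less_le_trans[OF _ le]) (simp add: w_def)
  show "n < 2 ^ w" "m < 2 ^ w" "k < 2 ^ w"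
    by (rule less_le_trans[OF less_exp le]; simp add: w_def)+
  show "4 < (2::nat) ^ w" using le[of 3] by (simp add: w_def)
qed

lemma inp_bounded: "inp i < 2 ^ w"
proof -
  have "x < 2 ^ w" if "x \<in> set (encode_cnf (n, \<phi>))" for x
  proof -
    have "encode_literal l < 2 ^ w" if "l \<in> set c" "c \<in> set \<phi>" for l c
      using kcnf that small_bounded(5) unfolding kcnf_def encode_literal_def
      by (cases l) (fastforce simp: of_bool_def)
    moreover have "length c < 2 ^ w" if "c \<in> set \<phi>" for c
      using kcnf that small_bounded(3) unfolding kcnf_def by (meson le_less_trans)
    ultimately show ?thesis
      using that small_bounded(1,2) by (auto simp: encode_cnf_def)
  qed
  moreover have "length (encode_cnf (n, \<phi>)) < 2 ^ w"
    using start_le[of m] small_bounded(4) by (simp add: encode_cnf_def start_def)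
  ultimately show ?thesis
    unfolding inp_def input_memory_def by (auto simp: nth_Cons split: nat.splits)
qed

lemma initial_bounded: "word_bounded w (input_memory (encode_cnf (n, \<phi>)))"
proof -
  have "input_memory (encode_cnf (n, \<phi>)) a i < 2 ^ w" for a i
    using inp_bounded[of i] by (cases "a = 0") (auto simp: inp_def input_memory_def)
  moreover have "1 \<le> w" by (simp add: w_def)
  ultimately show ?thesis by (simp add: word_bounded_def bits_le_iff)
qed

text \<open>A partially written output: each cell is final or still 0, and the events in
  \<open>P\<close> are complete, \<open>(i - 1) div 4\<close> being the event to which cell
  \<open>i\<close> belongs. As \<open>P\<close> only bounds the finished events from below, it may
  always be shrunk.\<close>

definition good :: "nat set \<Rightarrow> (nat \<Rightarrow> nat) \<Rightarrow> bool" where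
  "good P g \<longleftrightarrow> (\<forall>i. g i = out i \<or> g i = 0 \<and> (i = 0 \<or> (i - 1) div 4 \<notin> P))"

lemma good_mono: "good P g \<Longrightarrow> P' \<subseteq> P \<Longrightarrow> good P' g"
  unfolding good_def by blast

lemma good_insert:
  assumes "good P g" and q: "q < N"
  shows "good (insert q P) (g(4 * q + 1 := q, 4 * q + 2 := q div L div B,
      4 * q + 3 := opcode (op_at q), 4 * q + 4 := operand (op_at q)))" (is "good _ ?g")
  unfolding good_def
proof
  fix i
  consider "i = 4 * q + 1" | "i = 4 * q + 2" | "i = 4 * q + 3" | "i = 4 * q + 4"
    | "?g i = g i" "i = 0 \<or> (i - 1) div 4 \<noteq> q"
  proof -
    have "i = 0 \<or> (i - 1) div 4 \<noteq> q \<or> i = 4 * q + 1 \<or> i = 4 * q + 2 \<or> i = 4 * q + 3 \<or> i = 4 * q + 4"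
      by presburger
    then show ?thesis using that by (cases "i \<in> {4 * q + 1, 4 * q + 2, 4 * q + 3, 4 * q + 4}") auto
  qed
  then show "?g i = out i \<or> ?g i = 0 \<and> (i = 0 \<or> (i - 1) div 4 \<notin> insert q P)"
  proof cases
    case 5
    then show ?thesis using assms(1) unfolding good_def by (metis insertE)
  qed (use out_simps(2-5)[OF q] in \<open>simp_all\<close>)
qed

text \<open>What the main loops preserve. The arrays from 5 on must stay empty because the relocated
  race detector expects all its arrays but the input to be 0.\<close>

definition env :: "memory \<Rightarrow> bool" where
  "env s \<longleftrightarrow> s 0 = inp \<and> (\<forall>i\<le>h. s 3 i = 2 ^ i) \<and> s 2 vBlocks = B \<and> s 2 vClauses = m \<and>
     (\<forall>a\<ge>5. s a = (\<lambda>_. 0))"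

lemma env_update [simp]:
  "env (s(4 := g)) = env s"
  "env (s(4 := g, 2 := f)) = env (s(2 := f))"
  "v \<noteq> vBlocks \<Longrightarrow> v \<noteq> vClauses \<Longrightarrow> env (s(2 := f(v := x))) = env (s(2 := f))"
  by (auto simp: env_def)

text \<open>The operand \<open>e\<close> is evaluated only after other cells of the event have been
  stored, hence the requirement that its value be the same for every content of array 4.\<close>

lemma runs_emit:
  assumes "env s" "good P (s 4)" "s 2 vPos = p" "p < N" "s 2 vBlock = p div L"
    "opc = opcode (op_at p)" "\<And>g. val e (s(4 := g)) = operand (op_at p)"
    "\<And>g. good (insert p P) g \<Longrightarrow> Q (s(4 := g))"
  shows "runs w (emit opc e) (psize (emit opc e)) s Q"
proof -
  have B: "s 2 vBlocks = B" using assms(1) by (simp add: env_def)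
  have "p < 2 ^ w" using assms(4) le_N_bounded by simp
  moreover have "p div L div B < 2 ^ w"
    using \<open>p < 2 ^ w\<close> by (meson div_le_dividend le_less_trans)
  moreover have "opcode (op_at p) < 2 ^ w"
    using small_bounded(6) by (cases "op_at p") auto
  moreover have "operand (op_at p) < 2 ^ w"
    using operand_bound[OF assms(4)] le_N_bounded by simp
  moreover have "Q (s(4 := (s 4)(4 * p + 1 := p, 4 * p + 2 := p div L div B,
      4 * p + 3 := opcode (op_at p), 4 * p + 4 := operand (op_at p))))"
    using assms good_insert by blast
  ultimately show ?thesis
    unfolding emit_def
    by (intro runs_seq_psize runs_store) (simp_all add: assms(3,5-7) B)
qed

lemma literal_loop:
  assumes env: "env s" and c: "c < m" and q: "q < 2 * B"
    and s: "s 2 vPtr = start c" "s 2 vClause = c" "s 2 vBlock = q" "s 2 vFlag = 0" "s 2 vLit = 0"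
    and Q: "\<And>F. (F \<noteq> 0 \<longleftrightarrow> clause_hit h \<phi> q c) \<Longrightarrow>
      Q (s(2 := (s 2)(vFlag := F, vLit := length (\<phi> ! c))))"
  shows "runs w (While literal_guard literal_body)
     (loop_cost k (psize literal_body) literal_guard literal_body) s Q"
proof -
  define ok where "ok i \<longleftrightarrow> (case \<phi> ! c ! i of (x, b) \<Rightarrow>
      x mod 2 = q div B \<and> odd (q div 2 ^ (x div 2)) = b)" for i
  \<comment> \<open>The flag counts satisfied literals rather than recording a truth value;
    \<open>F \<le> j\<close> keeps it within the word length.\<close>
  define I where "I j s' \<longleftrightarrow> (\<exists>F\<le>j. s' = s(2 := (s 2)(vFlag := F, vLit := j)) \<and>
      (F \<noteq> 0 \<longleftrightarrow> (\<exists>i<j. ok i)))" for j and s' :: memory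
  have mem: "s 0 = inp" "\<And>i. i \<le> h \<Longrightarrow> s 3 i = 2 ^ i" "s 2 vBlocks = B"
    using env by (auto simp: env_def)
  have "runs w (While literal_guard literal_body)
     (loop_cost (length (\<phi> ! c)) (psize literal_body) literal_guard literal_body) s (I (length (\<phi> ! c)))"
  proof (rule runs_while[where I = I])
    show "I 0 s" using s by (auto simp: I_def fun_eq_iff)
  next
    fix j s' assume j: "j < length (\<phi> ! c)" and "I j s'"
    then obtain F where F: "F \<le> j" "s' = s(2 := (s 2)(vFlag := F, vLit := j))"
      "F \<noteq> 0 \<longleftrightarrow> (\<exists>i<j. ok i)"
      by (auto simp: I_def)
    obtain x b where xb: "\<phi> ! c ! j = (x, b)" by (cases "\<phi> ! c ! j")
    have code: "inp (start c + 1 + j) = 2 * x + of_bool b"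
      using inp_simps(4)[OF c j] xb by (simp add: encode_literal_def)
    have "x < n" using literal_range[OF c j] xb by simp
    then have xh: "x div 2 \<le> h" by (simp add: h_def)
    have qB: "q div B < 2" using q by (simp add: less_mult_imp_div_less)
    define v where "v = (x + q div B + 1) mod 2 * ((q div 2 ^ (x div 2) + (2 * x + of_bool b) + 1) mod 2)"
    have v: "val literal_expr s' = v"
    proof -
      have "(2 * x + of_bool b) div 2 = x" "(2 * x + of_bool b) div 4 = x div 2"
        by (simp_all add: div_mult2_eq[of _ 2 2, simplified])
      then show ?thesis
        using F(2) mem(1,3) mem(2)[OF xh] s code
        by (simp add: literal_expr_def code_expr_def v_def)
    qed
    \<comment> \<open>Each factor of \<open>v\<close> is 1 exactly if two parities agree, and
      \<open>q div B\<close> is its own parity, being 0 or 1.\<close>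
    have v_ok: "v = of_bool (ok j)"
    proof -
      have "q div B = 0 \<or> q div B = 1" using qB by linarith
      then show ?thesis
        unfolding v_def ok_def xb by (auto simp: mod2_eq_if)
    qed
    have "F + v \<le> Suc j" using F(1) v_ok by simp
    have "Suc j < 2 ^ w" using j clause_length[OF c] small_bounded(3) by linarith
    have "val literal_guard s' \<noteq> 0"
      using F(2) j mem(1) s inp_simps(3)[OF c] by (simp add: literal_guard_def)
    moreover have "runs w literal_body (psize literal_body) s' (I (Suc j))"
      unfolding literal_body_def
    proof (intro runs_seq_psize runs_store)
      show "val (var vFlag +\<^sub>e literal_expr) s' < 2 ^ w"
        using v F(2) \<open>F + v \<le> Suc j\<close> \<open>Suc j < 2 ^ w\<close> by simp
      let ?s = "s'(2 := (s' 2)(val (Const vFlag) s' := val (var vFlag +\<^sub>e literal_expr) s'))"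
      show "val (var vLit +\<^sub>e Const 1) ?s < 2 ^ w"
        using F(2) \<open>Suc j < 2 ^ w\<close> by simp
      have "F + v \<noteq> 0 \<longleftrightarrow> (\<exists>i<Suc j. ok i)"
        using F(3) v_ok by (auto simp: less_Suc_eq)
      then show "I (Suc j) (?s(2 := (?s 2)(val (Const vLit) ?s := val (var vLit +\<^sub>e Const 1) ?s)))"
        unfolding I_def using \<open>F + v \<le> Suc j\<close>
        by (intro exI[of _ "F + v"]) (simp add: F(2) v[unfolded F(2)] fun_eq_iff)
    qed
    ultimately show "val literal_guard s' \<noteq> 0 \<and> runs w literal_body (psize literal_body) s' (I (Suc j))"
      by blast
  next
    fix s' assume "I (length (\<phi> ! c)) s'"
    then show "val literal_guard s' = 0"
      using mem(1) s inp_simps(3)[OF c] by (auto simp: literal_guard_def I_def)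
  qed
  then show ?thesis
  proof (rule runs_mono)
    fix s' assume "I (length (\<phi> ! c)) s'"
    then obtain F where F: "s' = s(2 := (s 2)(vFlag := F, vLit := length (\<phi> ! c)))"
      "F \<noteq> 0 \<longleftrightarrow> (\<exists>i<length (\<phi> ! c). ok i)"
      by (auto simp: I_def)
    moreover have "(\<exists>i<length (\<phi> ! c). ok i) \<longleftrightarrow> clause_hit h \<phi> q c"
      unfolding clause_hit_def ok_def by (auto simp: in_set_conv_nth Bex_def)
    ultimately show "Q s'" using Q by blast
  qed (use clause_length[OF c] in simp)
qed

text \<open>Coordinate \<open>o'\<close> of a block is written together with its mirror image \<open>2 * m - o'\<close>; the loops
  run over clauses \<open>c\<close> and, inside, over blocks \<open>q\<close>. The final loop over the writes of the blocks
  is the case \<open>c = m\<close>.\<close>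

definition written :: "nat \<Rightarrow> nat \<Rightarrow> nat set" where
  "written c q = {p. p < N \<and> (min (p mod L) (2 * m - p mod L) < c \<or>
     min (p mod L) (2 * m - p mod L) = c \<and> p div L < q)}"

definition block_inv :: "nat \<Rightarrow> nat \<Rightarrow> memory \<Rightarrow> bool" where
  "block_inv c q s \<longleftrightarrow> env s \<and> good (written c q) (s 4) \<and> s 2 vPtr = start c \<and> s 2 vClause = c \<and>
     s 2 vBlock = q"

lemma mod_L_le: "p mod L \<le> 2 * m"
  using mod_less_divisor[OF L_pos, of p] by (simp add: L_def)

text \<open>The folded coordinate equals \<open>c\<close> only at coordinate \<open>c\<close> and at
  its mirror image, which for \<open>c = m\<close> coincide in the write.\<close>

lemma written_Suc:
  assumes "c \<le> m" "q < 2 * B"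
  shows "written c (Suc q) \<subseteq> insert (q * L + (2 * m - c)) (insert (q * L + c) (written c q))"
proof
  fix p assume p: "p \<in> written c (Suc q)"
  show "p \<in> insert (q * L + (2 * m - c)) (insert (q * L + c) (written c q))"
  proof (cases "p \<in> written c q")
    case False
    then have "min (p mod L) (2 * m - p mod L) = c" "p div L = q"
      using p by (auto simp: written_def)
    moreover have "p = p div L * L + p mod L" by simp
    moreover have "2 * m - p mod L = c \<Longrightarrow> p mod L = 2 * m - c"
      using mod_L_le[of p] by linarith
    ultimately show ?thesis by (metis insertCI min_def)
  qed simp
qed

lemma written_next: "written (Suc c) 0 \<subseteq> written c (2 * B)"
  using block_range by (auto simp: written_def)

lemma written_all: "{..<N} \<subseteq> written m (2 * B)"
proof
  fix p assume "p \<in> {..<N}"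
  moreover have "min (p mod L) (2 * m - p mod L) \<le> m" by linarith
  ultimately show "p \<in> written m (2 * B)"
    using block_range by (auto simp: written_def le_less)
qed

lemma written_empty: "written 0 0 = {}"
  by (simp add: written_def)

lemma block_in_range: "q < 2 * B \<Longrightarrow> o' \<le> 2 * m \<Longrightarrow> q * L + o' < N"
  by (intro pos_less_N) (auto simp: L_def)

lemma val_pos_expr: "env s \<Longrightarrow> s 2 vBlock = q \<Longrightarrow> val (pos_expr e) s = q * L + val e s"
  by (simp add: pos_expr_def env_def L_def)

lemma two_B_less: "2 * B < 2 ^ w"
proof -
  have "2 * B * 1 \<le> 2 * B * L" using L_pos by (intro mult_le_mono2) (simp add: Suc_le_eq)
  then show ?thesis using four_N_less unfolding N_def by linarith
qed

lemma block_end_runs: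
  assumes c: "c < m" and q: "q < 2 * B" and inv: "block_inv c q s"
    and F: "s 2 vFlag \<noteq> 0 \<longleftrightarrow> clause_hit h \<phi> q c"
  shows "runs w block_end (psize block_end) s (block_inv c (Suc q))"
proof -
  have env: "env s" and good: "good (written c q) (s 4)" and
    s: "s 2 vPtr = start c" "s 2 vClause = c" "s 2 vBlock = q"
    using inv by (auto simp: block_inv_def)
  define p1 where "p1 = q * L + c"
  define p2 where "p2 = q * L + (2 * m - c)"
  have pN: "p1 < N" "p2 < N"
    unfolding p1_def p2_def by (intro block_in_range; use c q in simp)+
  have oL: "c < L" "2 * m - c < L" using c by (auto simp: L_def)
  have p1: "p1 div L = q" "op_at p1 = Acq (lk q c)"
    using oL c by (auto simp: p1_def op_Acq)
  have p2: "p2 div L = q" "op_at p2 = Rel (lk q c)"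
    unfolding op_Rel using oL c pos_div[OF oL(2)] pos_mod[OF oL(2)] by (auto simp: p2_def simp del: rel_pos)
  have lkN: "lk q c < 2 ^ w"
    using operand_bound[OF pN(1)] p1 le_N_bounded by simp
  have qw: "Suc q < 2 ^ w" using q two_B_less by linarith
  define s1 where "s1 = s(2 := (s 2)(vLock := lk q c))"
  \<comment> \<open>Both branches lead to the same memory \<open>s1\<close>; the arbitrary
    continuation \<open>R\<close> lets the remaining code be executed once for both.\<close>
  have lock: "runs w (Cond (var vFlag)
       (assign vLock (var vClauses +\<^sub>e var vClause +\<^sub>e var vClauses *\<^sub>e (var vBlock div\<^sub>e var vBlocks)))
       (assign vLock (var vClause))) (psize (Cond (var vFlag)
       (assign vLock (var vClauses +\<^sub>e var vClause +\<^sub>e var vClauses *\<^sub>e (var vBlock div\<^sub>e var vBlocks)))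
       (assign vLock (var vClause)))) s R" if R: "R s1" for R
  proof (rule runs_cond; rule runs_store)
    assume "val (var vFlag) s \<noteq> 0"
    then have e: "val (var vClauses +\<^sub>e var vClause +\<^sub>e var vClauses *\<^sub>e (var vBlock div\<^sub>e var vBlocks)) s = lk q c"
      using F env s by (simp add: lk_def env_def)
    show "val (var vClauses +\<^sub>e var vClause +\<^sub>e var vClauses *\<^sub>e (var vBlock div\<^sub>e var vBlocks)) s < 2 ^ w"
      using e lkN by simp
    show "R (s(2 := (s 2)(val (Const vLock) s := val (var vClauses +\<^sub>e var vClause +\<^sub>e var vClauses *\<^sub>e (var vBlock div\<^sub>e var vBlocks)) s)))"
      unfolding e using R by (simp add: s1_def)
  next
    assume "val (var vFlag) s = 0"
    then have e: "val (var vClause) s = lk q c"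
      using F env s by (simp add: lk_def env_def)
    show "val (var vClause) s < 2 ^ w"
      using e lkN by simp
    show "R (s(2 := (s 2)(val (Const vLock) s := val (var vClause) s)))"
      unfolding e using R by (simp add: s1_def)
  qed
  show ?thesis
    unfolding block_end_def
  proof (intro runs_seq_psize lock runs_store)
    have e1: "env s1" using env by (simp add: s1_def)
    have v1: "val (pos_expr (var vClause)) s1 = p1"
      using val_pos_expr[OF e1] s by (simp add: s1_def p1_def)
    show "val (pos_expr (var vClause)) s1 < 2 ^ w"
      unfolding v1 using pN le_N_bounded by simp
    define s2 where "s2 = s1(2 := (s1 2)(vPos := p1))"
    have emit: "runs w (emit 2 (var vLock)) (psize (emit 2 (var vLock))) s2 R"
      if R: "\<And>g. good (insert p1 (written c q)) g \<Longrightarrow> R (s2(4 := g))" for R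
      by (rule runs_emit[where p = p1 and P = "written c q"])
        (use R e1 good pN p1 s in \<open>auto simp: s2_def s1_def\<close>)
    show "runs w (emit 2 (var vLock)) (psize (emit 2 (var vLock)))
       (s1(2 := (s1 2)(val (Const vPos) s1 := val (pos_expr (var vClause)) s1)))
       (\<lambda>s'. runs w (assign vPos (pos_expr (Const 2 *\<^sub>e var vClauses -\<^sub>e var vClause)) ;; emit 3 (var vLock) ;;
          assign vBlock (var vBlock +\<^sub>e Const 1))
          (psize (assign vPos (pos_expr (Const 2 *\<^sub>e var vClauses -\<^sub>e var vClause)) ;; emit 3 (var vLock) ;;
          assign vBlock (var vBlock +\<^sub>e Const 1))) s' (block_inv c (Suc q)))"
      unfolding v1 val.simps s2_def[symmetric]
    proof (rule emit)
      fix g assume g: "good (insert p1 (written c q)) g"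
      let ?s = "s2(4 := g)"
      have e2: "env ?s" using e1 by (simp add: s2_def)
      have v2: "val (pos_expr (Const 2 *\<^sub>e var vClauses -\<^sub>e var vClause)) ?s = p2"
        using val_pos_expr[OF e2] s e2 by (simp add: s2_def s1_def p2_def env_def)
      define s3 where "s3 = ?s(2 := (?s 2)(vPos := p2))"
      have e3: "env s3" using e2 by (simp add: s3_def)
      have last: "runs w (assign vBlock (var vBlock +\<^sub>e Const 1)) (psize (assign vBlock (var vBlock +\<^sub>e Const 1)))
         (s3(4 := g')) (block_inv c (Suc q))" if g': "good (insert p2 (insert p1 (written c q))) g'" for g'
      proof (rule runs_store)
        show "val (var vBlock +\<^sub>e Const 1) (s3(4 := g')) < 2 ^ w"
          using s qw by (simp add: s3_def s2_def s1_def)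
        have "good (written c (Suc q)) g'"
          using good_mono[OF g'] written_Suc[of c q] c q by (simp add: p1_def p2_def)
        then show "block_inv c (Suc q) ((s3(4 := g'))(2 := ((s3(4 := g')) 2)(val (Const vBlock) (s3(4 := g')) :=
            val (var vBlock +\<^sub>e Const 1) (s3(4 := g')))))"
          using e3 s by (simp add: block_inv_def s3_def s2_def s1_def env_def)
      qed
      show "runs w (assign vPos (pos_expr (Const 2 *\<^sub>e var vClauses -\<^sub>e var vClause)) ;; emit 3 (var vLock) ;;
          assign vBlock (var vBlock +\<^sub>e Const 1))
          (psize (assign vPos (pos_expr (Const 2 *\<^sub>e var vClauses -\<^sub>e var vClause)) ;; emit 3 (var vLock) ;;
          assign vBlock (var vBlock +\<^sub>e Const 1))) ?s (block_inv c (Suc q))"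
      proof (rule runs_seq_psize, rule runs_store)
        show "val (pos_expr (Const 2 *\<^sub>e var vClauses -\<^sub>e var vClause)) ?s < 2 ^ w"
          unfolding v2 using pN le_N_bounded by simp
        show "runs w (emit 3 (var vLock) ;; assign vBlock (var vBlock +\<^sub>e Const 1))
          (psize (emit 3 (var vLock) ;; assign vBlock (var vBlock +\<^sub>e Const 1)))
          (?s(2 := (?s 2)(val (Const vPos) ?s := val (pos_expr (Const 2 *\<^sub>e var vClauses -\<^sub>e var vClause)) ?s)))
          (block_inv c (Suc q))"
          unfolding v2 val.simps s3_def[symmetric]
        proof (rule runs_seq_psize, rule runs_emit[where p = p2 and P = "insert p1 (written c q)"])
          show "env s3" by (rule e3)
          show "good (insert p1 (written c q)) (s3 4)" using g by (simp add: s3_def)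
          show "s3 2 vPos = p2" by (simp add: s3_def)
          show "p2 < N" by (rule pN)
          show "s3 2 vBlock = p2 div L" using s p2 by (simp add: s3_def s2_def s1_def)
          show "3 = opcode (op_at p2)" using p2 by simp
          show "val (var vLock) (s3(4 := g')) = operand (op_at p2)" for g'
            using p2 by (simp add: s3_def s2_def s1_def)
        qed (rule last)
      qed
    qed
  qed
qed

definition block_cost :: nat where
  "block_cost = psize block_start + (loop_cost k (psize literal_body) literal_guard literal_body + psize block_end)"

lemma block_body_runs:
  assumes c: "c < m" and q: "q < 2 * B" and inv: "block_inv c q s"
  shows "runs w block_body block_cost s (block_inv c (Suc q))"
  unfolding block_body_def block_cost_def
proof (rule runs_seq_then)
  have s: "env s" "good (written c q) (s 4)" "s 2 vPtr = start c" "s 2 vClause = c" "s 2 vBlock = q"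
    using inv by (auto simp: block_inv_def)
  let ?s = "s(2 := (s 2)(vFlag := 0, vLit := 0))"
  show "runs w block_start (psize block_start) s (\<lambda>s'. s' = ?s)"
    unfolding block_start_def by (intro runs_seq_psize runs_store) simp_all
  fix s' assume s': "s' = ?s"
  show "runs w (While literal_guard literal_body ;; block_end)
      (loop_cost k (psize literal_body) literal_guard literal_body + psize block_end) s' (block_inv c (Suc q))"
  proof (rule runs_seq, rule literal_loop[OF _ c q])
    fix F :: nat assume "F \<noteq> 0 \<longleftrightarrow> clause_hit h \<phi> q c"
    then show "runs w block_end (psize block_end) (s'(2 := (s' 2)(vFlag := F, vLit := length (\<phi> ! c)))) (block_inv c (Suc q))"
      using s by (intro block_end_runs[OF c q]) (simp_all add: block_inv_def s')
  qed (use s in \<open>simp_all add: s'\<close>)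
qed

definition clause_cost :: nat where
  "clause_cost = psize (assign vBlock (Const 0)) +
     (loop_cost (2 * B) block_cost block_guard block_body
       + psize clause_end)"

lemma block_guard_val: "block_inv c q s \<Longrightarrow> val block_guard s = 2 * B - q"
  by (simp add: block_inv_def env_def block_guard_def)

definition clause_inv :: "nat \<Rightarrow> memory \<Rightarrow> bool" where
  "clause_inv c s \<longleftrightarrow> env s \<and> good (written c 0) (s 4) \<and> s 2 vPtr = start c \<and> s 2 vClause = c"

lemma clause_body_runs:
  assumes c: "c < m" and inv: "clause_inv c s"
  shows "runs w clause_body clause_cost s (clause_inv (Suc c))"
  unfolding clause_body_def clause_cost_def
proof (rule runs_seq, rule runs_store)
  let ?s = "s(2 := (s 2)(val (Const vBlock) s := val (Const 0) s))"
  have "block_inv c 0 ?s" using inv by (simp add: block_inv_def clause_inv_def)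
  then have loop: "runs w (While block_guard block_body)
     (loop_cost (2 * B) block_cost block_guard block_body)
     ?s (block_inv c (2 * B))"
    by (rule runs_while[where I = "block_inv c"]) (use block_body_runs[OF c] block_guard_val in auto)
  show "runs w (While block_guard block_body ;; clause_end)
     (loop_cost (2 * B) block_cost block_guard block_body
       + psize clause_end) ?s (clause_inv (Suc c))"
  proof (rule runs_seq_then[OF loop])
    fix s' assume s': "block_inv c (2 * B) s'"
    have len: "s' 0 (start c) = length (\<phi> ! c)"
      using s' inp_simps(3)[OF c] by (simp add: block_inv_def env_def)
    have "Suc c * (k + 1) \<le> m * (k + 1)" using c by (intro mult_le_mono1) simp
    then have "start (Suc c) < 2 ^ w"
      using start_le[of "Suc c"] small_bounded(4) c by linarith
    moreover have "Suc c < 2 ^ w" using c small_bounded(2) by linarith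
    moreover have "good (written (Suc c) 0) (s' 4)"
      using good_mono[OF _ written_next] s' by (simp add: block_inv_def)
    ultimately show "runs w clause_end (psize clause_end) s' (clause_inv (Suc c))"
      unfolding clause_end_def
      by (intro runs_seq_psize runs_store)
        (use s' len start_Suc[OF c] in \<open>simp_all add: block_inv_def clause_inv_def\<close>)
  qed
qed simp

lemma write_body_runs:
  assumes q: "q < 2 * B" and inv: "block_inv m q s"
  shows "runs w write_body (psize write_body) s (block_inv m (Suc q))"
  unfolding write_body_def
proof (rule runs_seq_psize, rule runs_store)
  have env: "env s" and good: "good (written m q) (s 4)" and
    s: "s 2 vPtr = start m" "s 2 vClause = m" "s 2 vBlock = q"
    using inv by (auto simp: block_inv_def)
  define p where "p = q * L + m"
  have mL: "m < L" by (simp add: L_def)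
  then have p: "p < N" "p div L = q" "op_at p = Write 0"
    using q block_in_range[of q m] pos_div[of m q] pos_mod[of m q] mL by (simp_all add: p_def op_Write)
  have v: "val (pos_expr (var vClauses)) s = p"
    using val_pos_expr[OF env] s env by (simp add: p_def env_def)
  then show "val (pos_expr (var vClauses)) s < 2 ^ w" using p le_N_bounded by simp
  define s1 where "s1 = s(2 := (s 2)(vPos := p))"
  have e1: "env s1" using env by (simp add: s1_def)
  have last: "runs w (assign vBlock (var vBlock +\<^sub>e Const 1)) (psize (assign vBlock (var vBlock +\<^sub>e Const 1)))
         (s1(4 := g)) (block_inv m (Suc q))" if g: "good (insert p (written m q)) g" for g
  proof (rule runs_store)
    show "val (var vBlock +\<^sub>e Const 1) (s1(4 := g)) < 2 ^ w"
      using s q two_B_less by (simp add: s1_def)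
    have "good (written m (Suc q)) g"
      using good_mono[OF g] written_Suc[of m q] q by (simp add: p_def)
    then show "block_inv m (Suc q) ((s1(4 := g))(2 := ((s1(4 := g)) 2)(val (Const vBlock) (s1(4 := g)) :=
            val (var vBlock +\<^sub>e Const 1) (s1(4 := g)))))"
      using e1 s by (simp add: block_inv_def s1_def)
  qed
  show "runs w (emit 1 (Const 0) ;; assign vBlock (var vBlock +\<^sub>e Const 1))
     (psize (emit 1 (Const 0) ;; assign vBlock (var vBlock +\<^sub>e Const 1)))
     (s(2 := (s 2)(val (Const vPos) s := val (pos_expr (var vClauses)) s))) (block_inv m (Suc q))"
    unfolding v val.simps s1_def[symmetric]
    by (rule runs_seq_psize, rule runs_emit[where p = p and P = "written m q"])
      (use e1 good p s last in \<open>simp_all add: s1_def\<close>)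
qed

definition power_inv :: "nat \<Rightarrow> memory \<Rightarrow> bool" where
  "power_inv i s \<longleftrightarrow> s 0 = inp \<and> s 2 vHalf = h \<and> s 2 vExp = i \<and> (\<forall>j\<le>i. s 3 j = 2 ^ j) \<and>
     (\<forall>a\<ge>4. s a = (\<lambda>_. 0))"

lemma B_bounded: "i \<le> h \<Longrightarrow> 2 ^ i < (2 :: nat) ^ w"
  by (intro power_strict_increasing) (auto simp: h_def w_def)

lemma h_bounded: "i \<le> h \<Longrightarrow> i < 2 ^ w"
  using B_bounded[of i] less_exp[of i] by linarith

lemma power_loop:
  assumes "power_inv 0 s"
  shows "runs w (While power_guard power_body)
    (loop_cost h (psize power_body) power_guard power_body)
    s (power_inv h)"
proof (rule runs_while[where I = power_inv])
  fix i s assume i: "i < h" and inv: "power_inv i s"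
  have "(2 :: nat) * 2 ^ i < 2 ^ w" using B_bounded[of "Suc i"] i by simp
  moreover have "Suc i < 2 ^ w" using h_bounded[of "Suc i"] i by simp
  ultimately have "runs w power_body (psize power_body) s (power_inv (Suc i))"
    unfolding power_body_def
    by (intro runs_seq_psize runs_store) (use inv in \<open>auto simp: power_inv_def le_Suc_eq\<close>)
  then show "val power_guard s \<noteq> 0 \<and> runs w power_body (psize power_body) s (power_inv (Suc i))"
    using i inv by (simp add: power_inv_def power_guard_def)
qed (use assms in \<open>simp_all add: power_inv_def power_guard_def\<close>)

definition generate_cost :: nat where
  "generate_cost = psize power_start + ((loop_cost h (psize power_body) power_guard power_body) +
     (psize prepare + ((loop_cost m clause_cost clause_guard clause_body) +
     (psize (assign vBlock (Const 0)) + ((loop_cost (2 * B) (psize write_body) block_guard write_body) + psize finish)))))"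

lemma finish_runs:
  assumes "block_inv m (2 * B) s"
  shows "runs w finish (psize finish) s (\<lambda>s'. s' 4 = out \<and> (\<forall>a\<ge>5. s' a = (\<lambda>_. 0)))"
  unfolding finish_def
proof (rule runs_store)
  let ?e = "Const 8 *\<^sub>e var vBlocks *\<^sub>e (Const 2 *\<^sub>e var vClauses +\<^sub>e Const 1)"
  have v: "val ?e s = 4 * N"
    using assms by (simp add: block_inv_def env_def N_def L_def)
  then show "val ?e s < 2 ^ w" using four_N_less by simp
  have "good {..<N} (s 4)"
    using assms good_mono[OF _ written_all] by (simp add: block_inv_def)
  then have "s 4 i = out i" if "i \<noteq> 0" for i
  proof (cases "i > 4 * N")
    case True
    then show ?thesis using \<open>good {..<N} (s 4)\<close> out_simps(6) unfolding good_def by metis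
  next
    case False
    then have "(i - 1) div 4 < N" using that by (intro less_mult_imp_div_less) auto
    then show ?thesis using \<open>good {..<N} (s 4)\<close> that unfolding good_def by blast
  qed
  then have "(s 4)(0 := 4 * N) = out"
    using out_simps(1) by (auto simp: fun_eq_iff)
  then show "(s(4 := (s 4)(val (Const 0) s := val ?e s))) 4 = out \<and>
     (\<forall>a\<ge>5. (s(4 := (s 4)(val (Const 0) s := val ?e s))) a = (\<lambda>_. 0))"
    using assms unfolding v by (simp add: block_inv_def env_def)
qed

lemma generate_runs:
  "runs w generate generate_cost (input_memory (encode_cnf (n, \<phi>)))
     (\<lambda>s'. s' 4 = out \<and> (\<forall>a\<ge>5. s' a = (\<lambda>_. 0)))" (is "runs w generate _ ?s ?Q")
proof -
  have s: "?s 0 = inp" "\<And>a. a > 0 \<Longrightarrow> ?s a = (\<lambda>_. 0)"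
    by (auto simp: inp_def input_memory_def fun_eq_iff)
  have start: "runs w power_start (psize power_start) ?s (power_inv 0)"
    unfolding power_start_def
    using h_bounded[of h] B_bounded[of 0] s inp_simps(1)
    by (intro runs_seq_psize runs_store) (auto simp: power_inv_def h_def)
  have prepare: "runs w prepare (psize prepare) s (clause_inv 0)" if "power_inv h s" for s
    unfolding prepare_def
    using that B_bounded[of h] small_bounded inp_simps(2)
    by (intro runs_seq_psize runs_store)
      (auto simp: power_inv_def clause_inv_def env_def good_def written_empty start_0)
  have clauses: "runs w (While clause_guard clause_body) (loop_cost m clause_cost clause_guard clause_body) s (clause_inv m)" if "clause_inv 0 s" for s
    using that
    by (rule runs_while[where I = clause_inv]) (use clause_body_runs in \<open>auto simp: clause_inv_def env_def clause_guard_def\<close>)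
  have reset: "runs w (assign vBlock (Const 0)) (psize (assign vBlock (Const 0))) s (block_inv m 0)"
    if "clause_inv m s" for s
    using that by (intro runs_store) (simp_all add: clause_inv_def block_inv_def)
  have writes: "runs w (While block_guard write_body) (loop_cost (2 * B) (psize write_body) block_guard write_body) s (block_inv m (2 * B))" if "block_inv m 0 s" for s
    using that by (rule runs_while[where I = "block_inv m"]) (use write_body_runs block_guard_val in auto)
  show ?thesis
    unfolding generate_def generate_cost_def
    by (rule runs_seq_then[OF start], rule runs_seq_then[OF power_loop], assumption,
        rule runs_seq_then[OF prepare], assumption, rule runs_seq_then[OF clauses], assumption,
        rule runs_seq_then[OF reset], assumption, rule runs_seq_then[OF writes], assumption,
        rule finish_runs)
qed

end

section \<open>From race detection to satisfiability\<close>

text \<open>After relocation the answer of the detector is in array 5, from where it is copied to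
  the array in which an answer is expected.\<close>

definition decide_sat :: "prog \<Rightarrow> prog" where
  "decide_sat p = (generate ;; shift_prog 4 p ;; Store 1 (Const 0) (Load 5 (Const 0)))"

context sat_reduction
begin

lemma has_race_iff: "has_osr_race \<sigma> \<longleftrightarrow> satisfiable \<phi>"
proof -
  have "x < 2 * h" if "c \<in> set \<phi>" "(x, b) \<in> set c" for c x b
  proof -
    have "x < n" using kcnf that unfolding kcnf_def by fast
    then show ?thesis by (simp add: h_def)
  qed
  then show ?thesis
    using satisfiable_iff_cover[of \<phi> h] race_iff_cover by simp
qed

text \<open>Copying the answer handles it twice, and by \<open>exec_bits\<close> it has at most
  \<open>1 + t2\<close> bits. With four unit charges for the address 0 the copy costs at most
  \<open>6 + 2 * t2\<close>; the run of \<open>p\<close> itself adds \<open>t2\<close>.\<close>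

lemma decide_sat_answers:
  assumes "answers_within p (encode_trace \<sigma>) b \<tau>"
  shows "answers_within (decide_sat p) (encode_cnf (n, \<phi>)) b (real (generate_cost * w) + 6 + 3 * \<tau>)"
proof -
  let ?s = "input_memory (encode_cnf (n, \<phi>))"
  obtain t1 s1 where 1: "exec generate ?s t1 s1" "t1 \<le> generate_cost * w" "s1 4 = out"
    "\<And>a. a \<ge> 5 \<Longrightarrow> s1 a = (\<lambda>_. 0)"
    using generate_runs initial_bounded unfolding runs_def by blast
  have start: "(\<lambda>a. s1 (a + 4)) = input_memory (encode_trace \<sigma>)"
  proof
    fix a show "s1 (a + 4) = input_memory (encode_trace \<sigma>) a"
      using 1(3,4) by (cases "a = 0") (auto simp: out_def input_memory_def)
  qed
  obtain t2 s2 where 2: "exec p (input_memory (encode_trace \<sigma>)) t2 s2" "s2 1 0 \<noteq> 0 \<longleftrightarrow> b" "real t2 \<le> \<tau>"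
    using assms unfolding answers_within_def by blast
  obtain r where r: "exec (shift_prog 4 p) s1 t2 r" "(\<lambda>a. r (a + 4)) = s2"
    using exec_shift[OF 2(1) start] by blast
  have r5: "r 5 0 = s2 1 0" using fun_cong[OF r(2), of 1] by simp
  let ?copy = "Store 1 (Const 0) (Load 5 (Const 0))"
  define t3 where "t3 = expr_cost (Const 0) r + expr_cost (Load 5 (Const 0)) r
    + bits (val (Const 0) r) + bits (val (Load 5 (Const 0)) r)"
  have 3: "exec ?copy r t3 (r(1 := (r 1)(0 := r 5 0)))"
    using exec.Store[of 1 "Const 0" "Load 5 (Const 0)" r] by (simp add: t3_def)
  have b0: "bits 0 = 1" by (simp add: bits_def floorlog_def)
  have "bits (r 5 0) \<le> 1 + t2"
    using exec_bits[OF 2(1), of 1 0] r5 b0 by (simp add: input_memory_def)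
  then have "t3 \<le> 6 + 2 * t2" by (simp add: t3_def b0)
  then have "real (t1 + (t2 + t3)) \<le> real (generate_cost * w + 6 + 3 * t2)"
    using 1(2) by (intro of_nat_mono) linarith
  also have "\<dots> \<le> real (generate_cost * w) + 6 + 3 * \<tau>" using 2(3) by simp
  finally have "real (t1 + (t2 + t3)) \<le> real (generate_cost * w) + 6 + 3 * \<tau>" .
  moreover have "exec (decide_sat p) ?s (t1 + (t2 + t3)) (r(1 := (r 1)(0 := r 5 0)))"
    unfolding decide_sat_def by (intro exec.Seq[OF 1(1)] exec.Seq[OF r(1)] 3)
  moreover have "(r(1 := (r 1)(0 := r 5 0))) 1 0 \<noteq> 0 \<longleftrightarrow> b" using 2(2) r5 by simp
  ultimately show ?thesis unfolding answers_within_def by blast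
qed

section \<open>Size of the trace and cost of the reduction\<close>

definition size_bound :: nat where
  "size_bound = (k + 1) * (2 * n + 1) ^ k + n + k + 4"

text \<open>For fixed \<open>k\<close>, \<open>size_bound\<close> is one polynomial in n that
  dominates \<open>m + 1\<close>, \<open>k + 1\<close> and \<open>w\<close>, so products of these
  collapse to its powers.\<close>

lemma m_less: "m + 1 \<le> size_bound" and w_le: "w \<le> size_bound"
  using kcnf_length_bound[OF kcnf] by (auto simp: size_bound_def w_def)

lemma N_le: "N \<le> 4 * B * size_bound"
proof -
  have "2 * B * L \<le> 2 * B * (2 * (m + 1))" by (intro mult_le_mono2) (simp add: L_def)
  also have "\<dots> \<le> 2 * B * (2 * size_bound)" using m_less by (intro mult_le_mono2) simp
  finally show ?thesis by (simp add: N_def)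
qed

end

text \<open>A number fixed by the program texts; it depends neither on the formula nor on n and k.
  The multiplicities are those needed to dominate the sums in the cost estimate.\<close>

definition unit_cost :: nat where
  "unit_cost = psize power_start + psize power_body + psize (While power_guard power_body) * 2 +
     psize prepare + psize (While clause_guard clause_body) * 2 + psize (assign vBlock (Const 0)) * 2 +
     psize write_body * 2 + psize (While block_guard write_body) * 3 + psize finish +
     psize block_start + psize literal_body + psize (While literal_guard literal_body) * 2 + psize block_end +
     psize (While block_guard block_body) * 3 + psize clause_end"

context sat_reduction
begin

text \<open>The nested loops over clauses, blocks and literals give the main term. Every other loop
  has length of order at most \<open>B * (k + 1)\<close>, the \<open>X\<close> of the proof.\<close>

lemma generate_cost_le: "generate_cost \<le> 10 * unit_cost * (B * ((k + 1) * (m + 1)))"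
proof -
  let ?u = unit_cost
  note u = unit_cost_def
  have B1: "1 \<le> B" "h \<le> B" using less_exp[of h] by simp_all
  have blk: "block_cost \<le> ?u * (k + 1)"
    by (simp add: block_cost_def u distrib_left distrib_right)
  have "clause_cost \<le> 2 * B * (?u * (k + 1) + ?u) + 3 * ?u"
  proof -
    have "psize (While block_guard block_body) \<le> ?u" "psize (assign vBlock (Const 0)) \<le> ?u"
       "psize clause_end \<le> ?u" by (simp_all add: u)
    moreover have "2 * B * (block_cost + psize (While block_guard block_body)) \<le> 2 * B * (?u * (k + 1) + ?u)"
      using blk calculation(1) by (intro mult_le_mono2 add_mono)
    ultimately show ?thesis unfolding clause_cost_def by linarith
  qed
  also have "\<dots> \<le> 7 * ?u * (B * (k + 1))"
  proof -
    have "?u * 1 \<le> ?u * (B * (k + 1))" using B1 by (intro mult_le_mono2) (simp add: Suc_le_eq)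
    moreover have "2 * B * (?u * (k + 1) + ?u) \<le> 2 * B * (?u * (k + 1) + ?u * (k + 1))"
      by (intro mult_le_mono2 add_mono) auto
    moreover have "2 * B * (?u * (k + 1) + ?u * (k + 1)) = 4 * (?u * (B * (k + 1)))"
      by (simp add: algebra_simps)
    ultimately show ?thesis by (simp only: mult.assoc)
  qed
  finally have cl: "clause_cost \<le> 7 * ?u * (B * (k + 1))" .
  define X where "X = B * (k + 1)"
  have "B \<le> X" by (simp add: X_def)
  then have X: "1 \<le> X" "B \<le> X" "h \<le> X" using B1 by linarith+
  have "m * (clause_cost + psize (While clause_guard clause_body)) \<le> m * (7 * ?u * X + ?u * X)"
  proof (intro mult_le_mono2 add_mono)
    have "?u * 1 \<le> ?u * X" using X by (intro mult_le_mono2)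
    moreover have "psize (While clause_guard clause_body) \<le> ?u" by (simp add: u)
    ultimately show "psize (While clause_guard clause_body) \<le> ?u * X" by linarith
  qed (use cl in \<open>simp add: X_def\<close>)
  moreover have "h * (psize power_body + psize (While power_guard power_body))
      \<le> X * (psize power_body + psize (While power_guard power_body))"
    using X by (intro mult_le_mono1)
  moreover have "2 * B * y \<le> X * (2 * y)" for y
    using mult_le_mono1[OF X(2), of "2 * y"] by (simp add: mult_ac)
  note this[of "psize write_body + psize (While block_guard write_body)"]
  moreover have "psize power_start + psize (While power_guard power_body) + psize prepare
      + psize (While clause_guard clause_body) + psize (assign vBlock (Const 0))
      + psize (While block_guard write_body) + psize finish
      \<le> X * (psize power_start + psize (While power_guard power_body) + psize prepare
      + psize (While clause_guard clause_body) + psize (assign vBlock (Const 0))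
      + psize (While block_guard write_body) + psize finish)" (is "?c \<le> X * ?c")
    using mult_le_mono1[OF X(1), of ?c] by simp
  ultimately have "generate_cost \<le> m * (7 * ?u * X + ?u * X) +
      X * (psize power_body + psize (While power_guard power_body)) +
      X * (2 * (psize write_body + psize (While block_guard write_body))) + X * ?c"
    unfolding generate_cost_def by linarith
  also have "\<dots> = m * (8 * (?u * X)) + X * (psize power_body + psize (While power_guard power_body)
      + 2 * (psize write_body + psize (While block_guard write_body)) + ?c)"
    by (simp only: distrib_left mult.assoc)
  also have "\<dots> \<le> m * (8 * (?u * X)) + X * ?u"
    by (intro add_left_mono mult_le_mono2) (simp add: u)
  also have "\<dots> \<le> 10 * ?u * (X * (m + 1))"
    by (simp add: algebra_simps)
  finally show ?thesis by (simp only: X_def mult.assoc)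
qed

text \<open>The three factors \<open>size_bound\<close> stand for \<open>k + 1\<close>,
  \<open>m + 1\<close> and the word length.\<close>

lemma generate_time_le: "generate_cost * w \<le> 10 * unit_cost * (B * size_bound ^ 3)"
proof -
  have "k + 1 \<le> size_bound" by (simp add: size_bound_def)
  then have "(k + 1) * (m + 1) * w \<le> size_bound * size_bound * size_bound"
    using m_less w_le by (intro mult_le_mono)
  then have "10 * unit_cost * B * ((k + 1) * (m + 1) * w) \<le> 10 * unit_cost * B * size_bound ^ 3"
    unfolding power3_eq_cube by (rule mult_le_mono2)
  moreover have "generate_cost * w \<le> 10 * unit_cost * B * ((k + 1) * (m + 1) * w)"
    using mult_le_mono1[OF generate_cost_le, of w] by (simp only: mult.assoc)
  ultimately show ?thesis by (simp only: mult.assoc)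
qed

lemma B_real: "real B \<le> 2 * 2 powr (real n / 2)"
proof -
  have "real B = 2 powr real h" by (simp add: powr_realpow)
  also have "\<dots> \<le> 2 powr (1 + real n / 2)" by (intro powr_mono) (auto simp: h_def)
  finally show ?thesis by (simp add: powr_add)
qed

end

section \<open>Comparison of growth rates\<close>

lemma power_le_exponential:
  fixes \<beta> :: real
  assumes "\<beta> > 0"
  shows "\<exists>c>0. \<forall>n. real (n + 1) ^ j \<le> c * 2 powr (\<beta> * real n)"
proof -
  \<comment> \<open>From \<open>1 + x \<le> exp x\<close>, n + 1 is at most a constant times
    2^(\<gamma> n), and the j-th power of this remains below exponent \<beta> n. Dividing by
    \<open>Suc j\<close> also covers \<open>j = 0\<close>.\<close>
  define \<gamma> where "\<gamma> = \<beta> / real (Suc j)"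
  define d where "d = min 1 (\<gamma> * ln 2)"
  have d: "0 < d" "d \<le> 1" "d \<le> \<gamma> * ln 2" and \<gamma>: "0 < \<gamma>"
    using assms by (auto simp: d_def \<gamma>_def)
  have "real (n + 1) ^ j \<le> (1 / d) ^ j * 2 powr (\<beta> * real n)" for n
  proof -
    have "d * real (n + 1) \<le> 1 + \<gamma> * ln 2 * real n"
      using d mult_right_mono[OF d(3), of "real n"] by (simp add: distrib_left)
    also have "\<dots> \<le> 2 powr (\<gamma> * real n)"
      using exp_ge_add_one_self[of "\<gamma> * ln 2 * real n"] by (simp add: powr_def mult_ac)
    finally have "real (n + 1) \<le> 1 / d * 2 powr (\<gamma> * real n)"
      using d by (simp add: field_simps)
    then have "real (n + 1) ^ j \<le> (1 / d * 2 powr (\<gamma> * real n)) ^ j"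
      by (intro power_mono) auto
    also have "\<dots> = (1 / d) ^ j * 2 powr (real j * (\<gamma> * real n))"
      by (simp only: power_mult_distrib) (simp add: powr_power mult.commute)
    also have "\<dots> \<le> (1 / d) ^ j * 2 powr (\<beta> * real n)"
    proof (intro mult_left_mono powr_mono)
      have "real j * \<gamma> \<le> \<beta>" using assms by (simp add: \<gamma>_def field_simps)
      then show "real j * (\<gamma> * real n) \<le> \<beta> * real n"
        using mult_right_mono[of "real j * \<gamma>" \<beta> "real n"] by (simp add: mult.assoc)
    qed (use d in auto)
    finally show ?thesis .
  qed
  then show ?thesis using d by (intro exI[of _ "(1 / d) ^ j"]) auto
qed

text \<open>The Landau bound holds only eventually; the additive constant absorbs the finitely many
  earlier values. The exponent can be raised to \<open>2 - e\<close> because the base is at least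
  1.\<close>

lemma bigo_powr_bound:
  fixes T :: "nat \<Rightarrow> real"
  assumes "T \<in> O(\<lambda>N. real N powr (2 - \<epsilon>))" and e: "e \<le> \<epsilon>"
  shows "\<exists>C>0. \<forall>N\<ge>1. T N \<le> C * real N powr (2 - e) + C"
proof -
  obtain c where c: "c > 0" "eventually (\<lambda>N. norm (T N) \<le> c * norm (real N powr (2 - \<epsilon>))) at_top"
    using landau_o.bigE[OF assms(1)] by blast
  then obtain N0 where N0: "\<And>N. N \<ge> N0 \<Longrightarrow> \<bar>T N\<bar> \<le> c * real N powr (2 - \<epsilon>)"
    by (auto simp: eventually_at_top_linorder)
  define C where "C = c + (\<Sum>N<N0. \<bar>T N\<bar>)"
  have "(\<Sum>N<N0. \<bar>T N\<bar>) \<ge> 0" by (intro sum_nonneg) auto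
  then have S: "C > 0" "c \<le> C" "(\<Sum>N<N0. \<bar>T N\<bar>) \<le> C" unfolding C_def using c by linarith+
  have "T N \<le> C * real N powr (2 - e) + C" if "N \<ge> 1" for N
  proof (cases "N < N0")
    case True
    then have "\<bar>T N\<bar> \<le> (\<Sum>N<N0. \<bar>T N\<bar>)" by (intro member_le_sum) auto
    moreover have "0 \<le> C * real N powr (2 - e)" using S by simp
    ultimately show ?thesis using S(3) by linarith
  next
    case False
    have "T N \<le> c * real N powr (2 - \<epsilon>)" using N0[of N] False by simp
    also have "\<dots> \<le> c * real N powr (2 - e)"
      using c that e by (intro mult_left_mono powr_mono) auto
    also have "\<dots> \<le> C * real N powr (2 - e)"
      using S(2) by (intro mult_right_mono) auto
    finally show ?thesis using S(1) by linarith
  qed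
  then show ?thesis using S(1) by blast
qed

lemma fast_race_detection_imp_fast_sat:
  assumes solv: "solvable_in_time trace_instances encode_trace (\<lambda>\<sigma>. card (Events \<sigma>)) has_osr_race
        (\<lambda>N. real N powr (2 - \<epsilon>))"
    and e: "0 < e" "e \<le> 1" "e \<le> \<epsilon>"
  shows "solvable_in_time (ksat_instances k) encode_cnf fst (\<lambda>F. satisfiable (snd F))
         (\<lambda>n. 2 powr ((1 - e / 4) * real n))"
proof -
  obtain p T where T: "T \<in> O(\<lambda>N. real N powr (2 - \<epsilon>))"
    and p: "\<And>\<sigma>. \<sigma> \<in> trace_instances \<Longrightarrow> answers_within p (encode_trace \<sigma>) (has_osr_race \<sigma>) (T (card (Events \<sigma>)))"
    using solv unfolding solvable_in_time_def by blast
  obtain C where C: "C > 0" "\<And>N. N \<ge> 1 \<Longrightarrow> T N \<le> C * real N powr (2 - e) + C"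
    using bigo_powr_bound[OF T e(3)] by blast
  \<comment> \<open>\<open>size_bound\<close> has degree at most \<open>k + 1\<close> in
    \<open>n + 1\<close>, up to a constant, and enters the time cubed. It may use up the exponent
    e/4.\<close>
  obtain c where c: "c > 0" "\<And>n. real (n + 1) ^ (3 * (k + 1)) \<le> c * 2 powr (e / 4 * real n)"
    using power_le_exponential[of "e / 4" "3 * (k + 1)"] e by auto
  \<comment> \<open>Here 20 is 10 from the generator times 2 from rounding up \<open>h\<close>, the
    numbers 6 and 3 are the overhead of \<open>decide_sat\<close>, and 64 is the square of the 8 in
    the bound on \<open>N\<close>.\<close>
  define D where "D = 20 * real unit_cost + 6 + 3 * (64 * C + C)"
  define A where "A = D * (real ((k + 1) * 2 ^ k + k + 5)) ^ 3 * c"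
  have ans: "answers_within (decide_sat p) (encode_cnf F) (satisfiable (snd F))
       (A * 2 powr ((1 - e / 4) * real (fst F)))" if F: "F \<in> ksat_instances k" for F
  proof -
    obtain n \<phi> where F': "F = (n, \<phi>)" "kcnf k n \<phi>" using F by (auto simp: ksat_instances_def)
    interpret sat_reduction n k \<phi> by unfold_locales (rule F')
    define Z where "Z = real size_bound"
    define E where "E = 2 powr ((1 - e / 2) * real n)"
    have Z1: "1 \<le> Z" by (simp add: Z_def size_bound_def)
    have E1: "1 \<le> E" unfolding E_def using e by (intro ge_one_powr_ge_zero) auto
    have Z3: "1 \<le> Z ^ 3" "Z ^ 2 \<le> Z ^ 3" using Z1 by (auto intro: power_increasing)
    have "e * real n \<le> 1 * real n" using e by (intro mult_right_mono) auto
    \<comment> \<open>Here \<open>e \<le> 1\<close> enters: writing the trace costs 2^(n/2) up to a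
      polynomial, and 1/2 is at most 1 - e/2.\<close>
    then have half: "2 powr (real n / 2) \<le> E"
      unfolding E_def by (intro powr_mono) (auto simp: field_simps)
    have gen: "real (generate_cost * w) \<le> 20 * real unit_cost * (Z ^ 3 * E)"
    proof -
      have "real (generate_cost * w) \<le> real (10 * unit_cost * (B * size_bound ^ 3))"
        using generate_time_le by (intro of_nat_mono)
      also have "\<dots> = 10 * real unit_cost * (real B * Z ^ 3)" by (simp add: Z_def)
      also have "\<dots> \<le> 10 * real unit_cost * (2 * E * Z ^ 3)"
        using B_real half Z1 by (intro mult_left_mono mult_right_mono) auto
      finally show ?thesis by (simp add: mult_ac)
    qed
    have "N \<ge> 1" using H_pos by (simp add: N_def Suc_le_eq)
    have "real N \<le> real (4 * B * size_bound)" using N_le by (intro of_nat_mono)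
    also have "\<dots> = 4 * real B * Z" by (simp add: Z_def)
    also have "\<dots> \<le> 4 * (2 * 2 powr (real n / 2)) * Z"
      using B_real Z1 by (intro mult_right_mono mult_left_mono) auto
    finally have "real N powr (2 - e) \<le> (8 * Z * 2 powr (real n / 2)) powr (2 - e)"
      using e by (intro powr_mono2) (auto simp: mult_ac)
    also have "\<dots> = (8 * Z) powr (2 - e) * E"
      using Z1 by (simp add: powr_mult powr_powr E_def field_simps)
    \<comment> \<open>Only the exponential factor needs the saving in the exponent; on the
      polynomial factor it is given away.\<close>
    also have "\<dots> \<le> (8 * Z) powr 2 * E"
      using Z1 e E1 by (intro mult_right_mono powr_mono) auto
    also have "\<dots> = 64 * (Z ^ 2 * E)" using Z1 by (simp add: power2_eq_square)
    also have "\<dots> \<le> 64 * (Z ^ 3 * E)" using Z3 E1 by (intro mult_left_mono mult_right_mono) auto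
    finally have NE: "real N powr (2 - e) \<le> 64 * (Z ^ 3 * E)" .
    have Z3E: "1 \<le> Z ^ 3 * E" using mult_mono[of 1 "Z ^ 3" 1 E] Z1 Z3 E1 by simp
    have "T N \<le> C * (64 * (Z ^ 3 * E)) + C * (Z ^ 3 * E)"
    proof -
      have "C * real N powr (2 - e) \<le> C * (64 * (Z ^ 3 * E))" using NE C by (intro mult_left_mono) auto
      moreover have "C * 1 \<le> C * (Z ^ 3 * E)" using Z3E C by (intro mult_left_mono) auto
      ultimately show ?thesis using C(2)[OF \<open>N \<ge> 1\<close>] by linarith
    qed
    then have "real (generate_cost * w) + 6 + 3 * T N \<le> 20 * real unit_cost * (Z ^ 3 * E)
        + 6 * (Z ^ 3 * E) + 3 * (C * (64 * (Z ^ 3 * E)) + C * (Z ^ 3 * E))"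
    proof (intro add_mono)
      show "6 \<le> 6 * (Z ^ 3 * E)" using Z3E by linarith
    qed (use gen in auto)
    also have "\<dots> = D * (Z ^ 3 * E)" by (simp add: D_def algebra_simps)
    also have "Z ^ 3 \<le> (real ((k + 1) * 2 ^ k + k + 5)) ^ 3 * (c * 2 powr (e / 4 * real n))"
    proof -
      have "size_bound \<le> ((k + 1) * 2 ^ k + k + 5) * (n + 1) ^ (k + 1)"
      proof -
        have "(2 * n + 1) ^ k \<le> (2 * (n + 1)) ^ k" by (intro power_mono) auto
        also have "\<dots> \<le> 2 ^ k * (n + 1) ^ (k + 1)"
          unfolding power_mult_distrib by (intro mult_le_mono2 power_increasing) auto
        finally have "(k + 1) * (2 * n + 1) ^ k \<le> (k + 1) * 2 ^ k * (n + 1) ^ (k + 1)"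
          by (metis mult.assoc mult_le_mono2)
        moreover have "n + 1 \<le> (n + 1) ^ (k + 1)" by (rule self_le_power) auto
        moreover have "k + 4 \<le> (k + 4) * (n + 1) ^ (k + 1)"
          using mult_le_mono2[of 1 "(n + 1) ^ (k + 1)" "k + 4"] by (metis le_add2 mult.right_neutral one_le_power)
        ultimately have "size_bound \<le> (k + 1) * 2 ^ k * (n + 1) ^ (k + 1) + (n + 1) ^ (k + 1)
            + (k + 4) * (n + 1) ^ (k + 1)"
          unfolding size_bound_def by linarith
        also have "\<dots> = ((k + 1) * 2 ^ k + k + 5) * (n + 1) ^ (k + 1)"
        proof -
          have "a * P + P + (k + 4) * P = (a + k + 5) * P" for a P :: nat by (simp add: algebra_simps)
          then show ?thesis .
        qed
        finally show ?thesis .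
      qed
      then have "Z \<le> real ((k + 1) * 2 ^ k + k + 5) * real (n + 1) ^ (k + 1)"
        unfolding Z_def by (metis of_nat_le_iff of_nat_mult of_nat_power)
      then have "Z ^ 3 \<le> (real ((k + 1) * 2 ^ k + k + 5) * real (n + 1) ^ (k + 1)) ^ 3"
        using Z1 by (intro power_mono) auto
      also have "\<dots> = real ((k + 1) * 2 ^ k + k + 5) ^ 3 * real (n + 1) ^ (3 * (k + 1))"
        by (simp only: power_mult_distrib power_mult[symmetric] mult.commute)
      also have "\<dots> \<le> real ((k + 1) * 2 ^ k + k + 5) ^ 3 * (c * 2 powr (e / 4 * real n))"
        using c(2) by (intro mult_left_mono) auto
      finally show ?thesis .
    qed
    finally have "real (generate_cost * w) + 6 + 3 * T N
       \<le> D * ((real ((k + 1) * 2 ^ k + k + 5)) ^ 3 * (c * 2 powr (e / 4 * real n)) * E)"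
      using C E1 by (simp add: D_def mult_left_mono mult_right_mono)
    also have "\<dots> = A * (2 powr (e / 4 * real n) * E)"
      by (simp add: A_def)
    also have "2 powr (e / 4 * real n) * E = 2 powr ((1 - e / 4) * real n)"
      unfolding E_def by (simp add: powr_add[symmetric] algebra_simps)
    finally have le: "real (generate_cost * w) + 6 + 3 * T N \<le> A * 2 powr ((1 - e / 4) * real n)" .
    have "answers_within (decide_sat p) (encode_cnf (n, \<phi>)) (satisfiable \<phi>)
        (real (generate_cost * w) + 6 + 3 * T N)"
      using decide_sat_answers[OF p[OF \<sigma>_instance]] by (simp add: has_race_iff card_\<sigma>)
    then show ?thesis
      using le unfolding F' fst_conv snd_conv answers_within_def by (meson order_trans)
  qed
  then show ?thesis
    unfolding solvable_in_time_def
    by (intro exI[of _ "decide_sat p"] exI[of _ "\<lambda>n. A * 2 powr ((1 - e / 4) * real n)"] conjI) simp_all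
qed

theorem theorem4p4:
  assumes "SETH"
  shows "\<forall>\<epsilon>::real. \<epsilon> > 0 \<longrightarrow>
    \<not> solvable_in_time trace_instances encode_trace (\<lambda>\<sigma>. card (Events \<sigma>)) has_osr_race
        (\<lambda>N. real N powr (2 - \<epsilon>))"
proof (intro allI impI notI)
  fix \<epsilon> :: real
  assume "\<epsilon> > 0" and solv: "solvable_in_time trace_instances encode_trace (\<lambda>\<sigma>. card (Events \<sigma>))
    has_osr_race (\<lambda>N. real N powr (2 - \<epsilon>))"
  \<comment> \<open>The cap at 1 makes large \<epsilon> harmless: a faster detector is also one of
    exponent \<open>2 - e\<close>. SETH is then applied with \<delta> = e/4.\<close>
  define e where "e = min \<epsilon> 1"
  have e: "0 < e" "e \<le> 1" "e \<le> \<epsilon>" using \<open>\<epsilon> > 0\<close> by (auto simp: e_def)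
  then obtain k where "\<not> solvable_in_time (ksat_instances k) encode_cnf fst (\<lambda>F. satisfiable (snd F))
         (\<lambda>n. 2 powr ((1 - e / 4) * real n))"
    using assms unfolding SETH_def by (metis zero_less_divide_iff zero_less_numeral)
  then show False using fast_race_detection_imp_fast_sat[OF solv e] by blast
qed

end
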